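(* Let $\Omega\subset\mathbb{R}^N$ be a bounded open connected set and let $\Theta$ be a Hausdorff continuous proper elliptic map on $\Omega$. Let $u\in \mathrm{USC}(\overline{\Omega})$ be $\Theta$-subharmonic in $\Omega$ and let $v\in\mathrm{LSC}(\overline{\Omega})$ be $\Theta$-superharmonic in $\Omega$. If $u\le v$ on $\partial\Omega$, then $u\le v$ in $\Omega$.
   Context: $\mathcal{S}(N)$ is the space of real symmetric $N\times N$ matrices with the usual partial order ($A\ge B$ iff $A-B$ is positive semidefinite); $\lambda_1(A)\le\dots\le\lambda_N(A)$ are the ordered eigenvalues of $A$ and $I$ is the identity. $\mathcal{Q}:=\{(s,P)\in\mathbb{R}\times\mathcal{S}(N): s\le 0,\ P\ge 0\}$. A map $\Theta$ from $\Omega$ to subsets of $\mathbb{R}\times\mathcal{S}(N)$ is a proper elliptic map if for each $x\in\Omega$, $\Theta(x)$ is closed, nonempty, not equal to $\mathbb{R}\times\mathcal{S}(N)$, and $\Theta(x)+\mathcal{Q}\subset\Theta(x)$. $\mathrm{USC}(E)$ (resp. $\mathrm{LSC}(E)$) denotes upper semicontinuous functions $E\to[-\infty,\infty)$ (resp. lower semicontinuous $E\to(-\infty,\infty]$). For $u$ defined near $x_0$, the upper test jets are $J^+_{x_0}u:=\{(\varphi(x_0),D^2\varphi(x_0)):\ \varphi$ is $C^2$ near $x_0$, $u\le\varphi$ near $x_0$, $u(x_0)=\varphi(x_0)\}$, and the lower test jets $J^-_{x_0}u$ are defined likewise with $u\ge\varphi$. A function $u\in\mathrm{USC}(\Omega)$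 is $\Theta$-subharmonic in $\Omega$ if $J^+_{x_0}u\subset\Theta(x_0)$ for every $x_0\in\Omega$; $v\in\mathrm{LSC}(\Omega)$ is $\Theta$-superharmonic in $\Omega$ if $J^-_{x_0}v\subset(\mathbb{R}\times\mathcal{S}(N))\setminus(\Theta(x_0))^\circ$ for every $x_0\in\Omega$ ($^\circ$ = interior). On $\mathbb{R}\times\mathcal{S}(N)$ use the norm $\|(r,A)\|=\max\{|r|,\max_i|\lambda_i(A)|\}$; for closed sets $\Phi,\Psi$ the Hausdorff distance is $d_{\mathcal H}(\Phi,\Psi)=\inf\{\varepsilon>0:\Phi\subset N_\varepsilon(\Psi),\ \Psi\subset N_\varepsilon(\Phi)\}\in[0,\infty]$, where $N_\varepsilon(\Phi)$ is the set of points at distance $<\varepsilon$ from some point of $\Phi$. $\Theta$ is Hausdorff continuous on $\Omega$ if for every $x\in\Omega$ and $\eta>0$ there is $\delta>0$ with $d_{\mathcal H}(\Theta(x),\Theta(y))<\eta$ for all $y\in\Omega$ with $|x-y|<\delta$. *)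

theory Defs
  imports "HOL-Analysis.Analysis" "HOL-Library.Extended_Real"
begin

type_synonym 'n jet = "real \<times> ((real, 'n) vec, 'n) vec"

definition symmetric_mat :: "real^'n^'n \<Rightarrow> bool" where
  "symmetric_mat A \<longleftrightarrow> transpose A = A"

definition Sym :: "(real^'n^'n) set" where
  "Sym = {A. symmetric_mat A}"

definition psd :: "real^'n^'n \<Rightarrow> bool" where
  "psd A \<longleftrightarrow> (\<forall>x. x \<bullet> (A *v x) \<ge> 0)"

definition eigenvalues :: "real^'n^'n \<Rightarrow> real set" where
  "eigenvalues A = {l. \<exists>v. v \<noteq> 0 \<and> A *v v = l *\<^sub>R v}"

definition jet_norm :: "'n::finite jet \<Rightarrow> real" where
  "jet_norm p = max \<bar>fst p\<bar> (Max (abs ` eigenvalues (snd p)))"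

definition jet_dist :: "'n::finite jet \<Rightarrow> 'n jet \<Rightarrow> real" where
  "jet_dist p q = jet_norm (fst p - fst q, snd p - snd q)"

definition JSpace :: "('n::finite jet) set" where
  "JSpace = UNIV \<times> Sym"

definition Qcone :: "('n::finite jet) set" where
  "Qcone = {(s, P). s \<le> 0 \<and> symmetric_mat P \<and> psd P}"

definition nbhd :: "real \<Rightarrow> ('n::finite jet) set \<Rightarrow> ('n jet) set" where
  "nbhd e \<Phi> = {q \<in> JSpace. \<exists>p\<in>\<Phi>. jet_dist q p < e}"

definition hausdorff_d :: "('n::finite jet) set \<Rightarrow> ('n jet) set \<Rightarrow> ereal" where
  "hausdorff_d \<Phi> \<Psi> = Inf {ereal e | e. e > 0 \<and> \<Phi> \<subseteq> nbhd e \<Psi> \<and> \<Psi> \<subseteq> nbhd e \<Phi>}"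

definition jet_interior :: "('n::finite jet) set \<Rightarrow> ('n jet) set" where
  "jet_interior \<Phi> = {p \<in> JSpace. \<exists>e>0. \<forall>q\<in>JSpace. jet_dist q p < e \<longrightarrow> q \<in> \<Phi>}"

definition proper_elliptic_map ::
  "(real^'n) set \<Rightarrow> (real^'n \<Rightarrow> ('n::finite jet) set) \<Rightarrow> bool" where
  "proper_elliptic_map \<Omega> \<Theta> \<longleftrightarrow> (\<forall>x\<in>\<Omega>.
     \<Theta> x \<subseteq> JSpace \<and> closed (\<Theta> x) \<and> \<Theta> x \<noteq> {} \<and> \<Theta> x \<noteq> JSpace \<and>
     {(r + s, A + P) | r A s P. (r, A) \<in> \<Theta> x \<and> (s, P) \<in> Qcone} \<subseteq> \<Theta> x)"

definition hausdorff_continuous ::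
  "(real^'n) set \<Rightarrow> (real^'n \<Rightarrow> ('n::finite jet) set) \<Rightarrow> bool" where
  "hausdorff_continuous \<Omega> \<Theta> \<longleftrightarrow> (\<forall>x\<in>\<Omega>. \<forall>\<eta>>0. \<exists>\<delta>>0. \<forall>y\<in>\<Omega>.
     dist x y < \<delta> \<longrightarrow> hausdorff_d (\<Theta> x) (\<Theta> y) < ereal \<eta>)"

definition usc_on :: "'a::topological_space set \<Rightarrow> ('a \<Rightarrow> ereal) \<Rightarrow> bool" where
  "usc_on S u \<longleftrightarrow> (\<forall>x\<in>S. u x \<noteq> \<infinity> \<and>
     (\<forall>c. u x < c \<longrightarrow> eventually (\<lambda>y. u y < c) (at x within S)))"

definition lsc_on :: "'a::topological_space set \<Rightarrow> ('a \<Rightarrow> ereal) \<Rightarrow> bool" where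
  "lsc_on S v \<longleftrightarrow> (\<forall>x\<in>S. v x \<noteq> -\<infinity> \<and>
     (\<forall>c. c < v x \<longrightarrow> eventually (\<lambda>y. c < v y) (at x within S)))"

definition C2_on_ball ::
  "real^'n \<Rightarrow> real \<Rightarrow> (real^'n \<Rightarrow> real) \<Rightarrow> (real^'n \<Rightarrow> real^'n) \<Rightarrow> (real^'n \<Rightarrow> real^'n^'n) \<Rightarrow> bool"
  where
  "C2_on_ball x0 e \<phi> g H \<longleftrightarrow> e > 0 \<and>
     (\<forall>x\<in>ball x0 e. (\<phi> has_derivative (\<lambda>h. g x \<bullet> h)) (at x) \<and>
                    (g has_derivative (\<lambda>h. H x *v h)) (at x)) \<and>
     continuous_on (ball x0 e) H"

definition upper_jets :: "(real^'n \<Rightarrow> ereal) \<Rightarrow> real^'n \<Rightarrow> ('n::finite jet) set" where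
  "upper_jets u x0 = {(\<phi> x0, H x0) | \<phi> g H. \<exists>e. C2_on_ball x0 e \<phi> g H \<and>
      (\<forall>x\<in>ball x0 e. u x \<le> ereal (\<phi> x)) \<and> u x0 = ereal (\<phi> x0)}"

definition lower_jets :: "(real^'n \<Rightarrow> ereal) \<Rightarrow> real^'n \<Rightarrow> ('n::finite jet) set" where
  "lower_jets u x0 = {(\<phi> x0, H x0) | \<phi> g H. \<exists>e. C2_on_ball x0 e \<phi> g H \<and>
      (\<forall>x\<in>ball x0 e. ereal (\<phi> x) \<le> u x) \<and> u x0 = ereal (\<phi> x0)}"

definition subharmonic ::
  "(real^'n \<Rightarrow> ('n::finite jet) set) \<Rightarrow> (real^'n) set \<Rightarrow> (real^'n \<Rightarrow> ereal) \<Rightarrow> bool" where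
  "subharmonic \<Theta> \<Omega> u \<longleftrightarrow> usc_on \<Omega> u \<and> (\<forall>x0\<in>\<Omega>. upper_jets u x0 \<subseteq> \<Theta> x0)"

definition superharmonic ::
  "(real^'n \<Rightarrow> ('n::finite jet) set) \<Rightarrow> (real^'n) set \<Rightarrow> (real^'n \<Rightarrow> ereal) \<Rightarrow> bool" where
  "superharmonic \<Theta> \<Omega> v \<longleftrightarrow> lsc_on \<Omega> v \<and>
     (\<forall>x0\<in>\<Omega>. lower_jets v x0 \<subseteq> JSpace - jet_interior (\<Theta> x0))"

end

theory Submission
  imports Defs
begin

text \<open>
  Adding a small multiple of \<open>|x|\<^sup>2 - R\<^sup>2\<close> to \<open>u\<close> makes it strictly subharmonic. If comparison fails, the
  sup-convolutions \<open>U\<close> of \<open>u\<close> and \<open>W\<close> of \<open>- v\<close> are semiconvex on the whole space and \<open>U + W\<close> has a positive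
  maximum. Since \<open>\<Theta>\<close> does not depend on the gradient and is Hausdorff continuous, it suffices
  to find nearby points \<open>x\<^sub>1\<close>, \<open>x\<^sub>2\<close>, almost maximal, where \<open>U\<close> and \<open>W\<close> are touched from above by quadratic polynomials
  with Hessians \<open>A + \<eta> I\<close> and \<open>- A + \<eta> I\<close>.

  Let \<open>K\<close> be the set of points where \<open>U + W\<close> is touched from above by an affine function of small slope, and
  \<open>\<Gamma>\<close> the infimum of these affine functions. The slope is a Lipschitz function on \<open>K\<close> and covers a ball,
  so \<open>K\<close> is not negligible. The function \<open>\<Gamma> - W\<close> is semiconcave and lies above the
  semiconvex \<open>U\<close>, so a function \<open>\<psi>\<close> that is both semiconvex and semiconcave fits in between; it equals \<open>U\<close> on \<open>K\<close>.
  Neither Alexandrov's nor Rademacher's theorem is needed: at some point of \<open>K\<close> and some small scale \<open>r\<close>,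
  \<open>\<psi>\<close> is within \<open>\<eta> r\<^sup>2\<close> of a quadratic polynomial, because its rescaled third differences
  tend to zero in mean square along dyadic scales. This polynomial, slightly bent, touches \<open>U\<close> from
  above, and minus it (up to an affine function) touches \<open>W\<close>.
\<close>

section \<open>Semiconvex functions\<close>

text \<open>Convexity of \<open>f\<close> plus c/2 times the squared norm, written as a bound on the
  convexity defect. In this form no centre is singled out, so suprema, translates and averages can
  be handled by direct comparison.\<close>

definition semiconvex :: "real \<Rightarrow> ('a::real_inner \<Rightarrow> real) \<Rightarrow> bool" where
  "semiconvex c f \<longleftrightarrow> (\<forall>x y t. 0 \<le> t \<longrightarrow> t \<le> 1 \<longrightarrow>
     f ((1 - t) *\<^sub>R x + t *\<^sub>R y) \<le> (1 - t) * f x + t * f y + c / 2 * (t * (1 - t)) * (norm (x - y))\<^sup>2)"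

lemma semiconvexD:
  assumes "semiconvex c f" "0 \<le> t" "t \<le> 1"
  shows "f ((1 - t) *\<^sub>R x + t *\<^sub>R y) \<le> (1 - t) * f x + t * f y + c / 2 * (t * (1 - t)) * (norm (x - y))\<^sup>2"
  using assms unfolding semiconvex_def by blast

lemma norm_sq_convex_combination:
  fixes a x y :: "'a::real_inner"
  shows "(norm ((1 - t) *\<^sub>R x + t *\<^sub>R y - a))\<^sup>2 =
    (1 - t) * (norm (x - a))\<^sup>2 + t * (norm (y - a))\<^sup>2 - t * (1 - t) * (norm (x - y))\<^sup>2"
  unfolding power2_norm_eq_inner by (simp add: inner_simps inner_commute algebra_simps)

text \<open>The convexity defect of the squared distance to \<open>a\<close> is exactly the
  correction term, whatever \<open>a\<close> is. This gives access to the theory of convex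
  functions.\<close>

lemma semiconvex_iff_convex_on:
  "semiconvex c f \<longleftrightarrow> convex_on UNIV (\<lambda>x. f x + c / 2 * (norm (x - a))\<^sup>2)"
proof -
  have eq: "(f ((1 - t) *\<^sub>R x + t *\<^sub>R y) \<le> (1 - t) * f x + t * f y + c / 2 * (t * (1 - t)) * (norm (x - y))\<^sup>2)
    \<longleftrightarrow> (f ((1 - t) *\<^sub>R x + t *\<^sub>R y) + c / 2 * (norm ((1 - t) *\<^sub>R x + t *\<^sub>R y - a))\<^sup>2
      \<le> (1 - t) * (f x + c / 2 * (norm (x - a))\<^sup>2) + t * (f y + c / 2 * (norm (y - a))\<^sup>2))" for x y t
    unfolding norm_sq_convex_combination[of t x y a]
    by (simp add: algebra_simps add_divide_distrib diff_divide_distrib)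
  show ?thesis
  proof
    assume "semiconvex c f"
    then show "convex_on UNIV (\<lambda>x. f x + c / 2 * (norm (x - a))\<^sup>2)"
      by (intro convex_onI) (use eq in \<open>auto simp: semiconvex_def\<close>)
  next
    assume c: "convex_on UNIV (\<lambda>x. f x + c / 2 * (norm (x - a))\<^sup>2)"
    show "semiconvex c f"
      unfolding semiconvex_def eq using convex_onD[OF c] by auto
  qed
qed

lemma semiconvex_continuous:
  fixes f :: "'a::euclidean_space \<Rightarrow> real"
  assumes "semiconvex c f"
  shows "continuous_on UNIV f"
proof -
  have "continuous_on UNIV (\<lambda>x. f x + c / 2 * (norm (x - 0))\<^sup>2)"
    using assms by (intro convex_on_continuous) (auto simp: semiconvex_iff_convex_on[of c f 0])
  then have "continuous_on UNIV (\<lambda>x. (f x + c / 2 * (norm (x - 0))\<^sup>2) - c / 2 * (norm (x - 0))\<^sup>2)"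
    by (rule continuous_on_diff) (intro continuous_intros)
  then show ?thesis by simp
qed

lemma semiconvex_midpoint:
  assumes "semiconvex c f"
  shows "2 * f x \<le> f (x + h) + f (x - h) + c * (norm h)\<^sup>2"
proof -
  have e: "(1 - 1/2) *\<^sub>R (x + h) + (1/2) *\<^sub>R (x - h) = x"
    by (simp add: algebra_simps flip: scaleR_add_left)
  have "(norm (x + h - (x - h)))\<^sup>2 = 4 * (norm h)\<^sup>2"
  proof -
    have "x + h - (x - h) = 2 *\<^sub>R h" by (simp add: scaleR_2)
    then show ?thesis by (simp add: power_mult_distrib)
  qed
  then show ?thesis
    using semiconvexD[OF assms, of "1/2" "x + h" "x - h"] unfolding e by (simp add: field_simps)
qed

lemma semiconvex_add:
  assumes "semiconvex c f" "semiconvex d g"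
  shows "semiconvex (c + d) (\<lambda>x. f x + g x)"
  unfolding semiconvex_def
proof (intro allI impI)
  fix x y :: 'a and t :: real assume t: "0 \<le> t" "t \<le> 1"
  show "f ((1 - t) *\<^sub>R x + t *\<^sub>R y) + g ((1 - t) *\<^sub>R x + t *\<^sub>R y)
    \<le> (1 - t) * (f x + g x) + t * (f y + g y) + (c + d) / 2 * (t * (1 - t)) * (norm (x - y))\<^sup>2"
    using semiconvexD[OF assms(1) t, of x y] semiconvexD[OF assms(2) t, of x y]
    by (simp add: algebra_simps add_divide_distrib)
qed

text \<open>Division by h^2 cancels the factor produced by the dilation, so the constant survives
  every zoom; the bounds on zoomed functions below are therefore uniform in the scale.\<close>

lemma semiconvex_rescale:
  assumes "semiconvex c f" "h > 0"
  shows "semiconvex c (\<lambda>y. f (a + h *\<^sub>R y) / h\<^sup>2)"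
  unfolding semiconvex_def
proof (intro allI impI)
  fix x y :: 'a and t :: real assume t: "0 \<le> t" "t \<le> 1"
  have e: "(1 - t) *\<^sub>R (a + h *\<^sub>R x) + t *\<^sub>R (a + h *\<^sub>R y) = a + h *\<^sub>R ((1 - t) *\<^sub>R x + t *\<^sub>R y)"
    by (simp add: algebra_simps)
  have n: "(norm (a + h *\<^sub>R x - (a + h *\<^sub>R y)))\<^sup>2 = h\<^sup>2 * (norm (x - y))\<^sup>2"
    using assms(2) by (simp add: power_mult_distrib flip: scaleR_diff_right)
  have "f (a + h *\<^sub>R ((1 - t) *\<^sub>R x + t *\<^sub>R y)) / h\<^sup>2 \<le>
    ((1 - t) * f (a + h *\<^sub>R x) + t * f (a + h *\<^sub>R y) + c / 2 * (t * (1 - t)) * (h\<^sup>2 * (norm (x - y))\<^sup>2)) / h\<^sup>2"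
    using semiconvexD[OF assms(1) t, of "a + h *\<^sub>R x" "a + h *\<^sub>R y"] unfolding e n
    by (intro divide_right_mono) auto
  also have "\<dots> = (1 - t) * (f (a + h *\<^sub>R x) / h\<^sup>2) + t * (f (a + h *\<^sub>R y) / h\<^sup>2)
      + c / 2 * (t * (1 - t)) * (norm (x - y))\<^sup>2"
    using assms(2) by (simp add: field_simps)
  finally show "f (a + h *\<^sub>R ((1 - t) *\<^sub>R x + t *\<^sub>R y)) / h\<^sup>2 \<le> \<dots>" .
qed

section \<open>Iterated forward differences\<close>

definition fdiff :: "'a::ab_group_add \<Rightarrow> ('a \<Rightarrow> real) \<Rightarrow> 'a \<Rightarrow> real" where
  "fdiff a f = (\<lambda>x. f (x + a) - f x)"

text \<open>The four points form a parallelogram centred at \<open>m\<close>. The mixed difference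
  is the symmetric second difference along one diagonal minus the one along the other; each is
  bounded on both sides, and the parallelogram law adds up the squared half-diagonals.\<close>

lemma second_difference_bound:
  fixes f :: "'a::real_inner \<Rightarrow> real"
  assumes "semiconvex c f" "semiconvex c (\<lambda>x. - f x)"
  shows "\<bar>fdiff a (fdiff b f) x\<bar> \<le> c * ((norm a)\<^sup>2 + (norm b)\<^sup>2) / 2"
proof -
  define m where "m = x + (1/2) *\<^sub>R (a + b)"
  define p where "p = (1/2) *\<^sub>R (a + b)"
  define q where "q = (1/2) *\<^sub>R (a - b)"
  have hh: "(1/2) *\<^sub>R v + (1/2) *\<^sub>R v = v" for v :: 'a
    by (simp flip: scaleR_add_left)
  have e: "x = m - p" "x + a + b = m + p" "x + a = m + q" "x + b = m - q"
    using hh[of a] hh[of b] unfolding m_def p_def q_def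
    by (simp_all add: algebra_simps)
  have n: "(norm p)\<^sup>2 + (norm q)\<^sup>2 = ((norm a)\<^sup>2 + (norm b)\<^sup>2) / 2"
    unfolding p_def q_def
    by (simp add: power2_norm_eq_inner inner_simps inner_commute field_simps)
  have "2 * f m \<le> f (m + p) + f (m - p) + c * (norm p)\<^sup>2"
       "2 * f m \<le> f (m + q) + f (m - q) + c * (norm q)\<^sup>2"
       "f (m + p) + f (m - p) \<le> 2 * f m + c * (norm p)\<^sup>2"
       "f (m + q) + f (m - q) \<le> 2 * f m + c * (norm q)\<^sup>2"
    using semiconvex_midpoint[OF assms(1), of m p] semiconvex_midpoint[OF assms(1), of m q]
      semiconvex_midpoint[OF assms(2), of m p] semiconvex_midpoint[OF assms(2), of m q] by linarith+
  moreover have "fdiff a (fdiff b f) x = f (m + p) + f (m - p) - (f (m + q) + f (m - q))"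
    unfolding fdiff_def by (simp flip: e)
  ultimately have "\<bar>fdiff a (fdiff b f) x\<bar> \<le> c * ((norm p)\<^sup>2 + (norm q)\<^sup>2)"
    by (simp add: algebra_simps)
  then show ?thesis unfolding n by simp
qed

section \<open>Mean-square decay of third differences\<close>

definition cube :: "real \<Rightarrow> 'a::euclidean_space set" where
  "cube r = cbox (- (r *\<^sub>R One)) (r *\<^sub>R One)"

lemma mem_cube: "x \<in> cube r \<longleftrightarrow> (\<forall>i\<in>Basis. \<bar>x \<bullet> i\<bar> \<le> r)"
  unfolding cube_def mem_box by (auto simp: abs_le_iff)

lemma integrable_on_cube:
  fixes f :: "'a::euclidean_space \<Rightarrow> real"
  assumes "continuous_on UNIV f"
  shows "f integrable_on cube r"
  unfolding cube_def using assms by (intro integrable_continuous) (rule continuous_on_subset, auto)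

lemma integral_cube_shift_le:
  fixes f :: "'a::euclidean_space \<Rightarrow> real"
  assumes f: "continuous_on UNIV f" "\<And>x. 0 \<le> f x" and s: "norm s \<le> d"
  shows "integral (cube r) (\<lambda>x. f (x + s)) \<le> integral (cube (r + d)) f"
proof -
  let ?a = "- (r *\<^sub>R One) :: 'a" and ?b = "r *\<^sub>R One :: 'a"
  have "integral (cube r) (\<lambda>x. f (x + s)) = integral (cbox (?a + s) (?b + s)) f"
    unfolding cube_def using integral_shift_cbox[of "?a + s" s "?b + s" f] by simp
  also have "\<dots> \<le> integral (cube (r + d)) f"
  proof (rule integral_subset_le)
    show "cbox (?a + s) (?b + s) \<subseteq> cube (r + d)"
    proof
      fix x assume x: "x \<in> cbox (?a + s) (?b + s)"
      have "\<bar>x \<bullet> i\<bar> \<le> r + d" if i: "i \<in> Basis" for i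
      proof -
        have "\<bar>s \<bullet> i\<bar> \<le> d" using Basis_le_norm[OF i, of s] s by linarith
        moreover have "- r + s \<bullet> i \<le> x \<bullet> i" "x \<bullet> i \<le> r + s \<bullet> i"
          using x i by (auto simp: mem_box inner_add_left inner_diff_left)
        ultimately show ?thesis by linarith
      qed
      then show "x \<in> cube (r + d)" by (auto simp: mem_cube)
    qed
    show "f integrable_on cbox (?a + s) (?b + s)"
      using f by (intro integrable_continuous) (rule continuous_on_subset, auto)
  qed (use f integrable_on_cube in auto)
  finally show ?thesis .
qed

text \<open>The variance of four numbers is one sixteenth of the sum of their six squared pairwise
  differences; one pair is kept.\<close>

lemma mean_square_four_le:
  fixes p q r s :: real
  shows "((p + q + r + s) / 4)\<^sup>2 + (q - p)\<^sup>2 / 16 \<le> (p\<^sup>2 + q\<^sup>2 + r\<^sup>2 + s\<^sup>2) / 4"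
proof -
  have "(p\<^sup>2 + q\<^sup>2 + r\<^sup>2 + s\<^sup>2) / 4 - ((p + q + r + s) / 4)\<^sup>2 - (q - p)\<^sup>2 / 16
    = ((p - r)\<^sup>2 + (p - s)\<^sup>2 + (q - r)\<^sup>2 + (q - s)\<^sup>2 + (r - s)\<^sup>2) / 16"
    by (simp add: power2_eq_square field_simps)
  also have "\<dots> \<ge> 0" by simp
  finally show ?thesis by linarith
qed

text \<open>The rescaled mixed second difference at scale \<open>2h\<close> is the mean of four translates of the one at
  scale \<open>h\<close>; hence its \<open>L\<^sup>2\<close> norm increases as \<open>h\<close> is halved, and the gain
  controls a third difference.\<close>

lemma third_difference_L2_tendsto_0:
  fixes f :: "'a::euclidean_space \<Rightarrow> real"
  assumes f: "semiconvex c f" "semiconvex c (\<lambda>x. - f x)"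
  defines "h \<equiv> \<lambda>k::nat. (1/2::real) ^ k"
  shows "(\<lambda>k. integral (cube r) (\<lambda>x. (fdiff (h k *\<^sub>R a) (fdiff (h k *\<^sub>R a) (fdiff (h k *\<^sub>R b) f)) x / (h k)\<^sup>2)\<^sup>2))
    \<longlonglongrightarrow> 0"
proof -
  define d where "d = norm a + norm b"
  define D where "D k x = fdiff (h k *\<^sub>R a) (fdiff (h k *\<^sub>R b) f) x / (h k)\<^sup>2" for k x
  define T where "T k x = fdiff (h k *\<^sub>R a) (fdiff (h k *\<^sub>R a) (fdiff (h k *\<^sub>R b) f)) x / (h k)\<^sup>2" for k x
  \<comment> \<open>The cube grows at each step by just enough to contain the translates in
    \<open>avg\<close>; the total growth stays below \<open>d\<close>.\<close>
  define R where "R k = r + d * (1 - h k)" for k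
  define I where "I k = integral (cube (R k)) (\<lambda>x. (D k x)\<^sup>2)" for k
  define B where "B = c * ((norm a)\<^sup>2 + (norm b)\<^sup>2) / 2"
  have h: "h k > 0" "h k \<le> 1" "h k = 2 * h (Suc k)" for k
    by (auto simp: h_def power_le_one)
  have d0: "d \<ge> 0" by (simp add: d_def)
  have cont: "continuous_on UNIV f" using f semiconvex_continuous by blast
  have contf: "continuous_on UNIV (\<lambda>x. f (x + s))" for s
    by (rule continuous_on_compose2[OF cont]) (auto intro!: continuous_intros)
  have contD: "continuous_on UNIV (D k)" for k
    unfolding D_def fdiff_def add.assoc using h(1)[of k] by (intro continuous_intros contf cont) auto
  have contDs: "continuous_on UNIV (\<lambda>x. D k (x + s))" for k s
    by (rule continuous_on_compose2[OF contD]) (auto intro!: continuous_intros)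
  have T_eq: "T k x = D k (x + h k *\<^sub>R a) - D k x" for k x
    unfolding T_def D_def by (subst fdiff_def) (rule diff_divide_distrib)
  have contT: "continuous_on UNIV (T k)" for k
    unfolding T_eq by (intro continuous_intros contD contDs)
  have bound: "\<bar>D k x\<bar> \<le> B" for k x
  proof -
    have "\<bar>fdiff (h k *\<^sub>R a) (fdiff (h k *\<^sub>R b) f) x\<bar> \<le> c * ((norm (h k *\<^sub>R a))\<^sup>2 + (norm (h k *\<^sub>R b))\<^sup>2) / 2"
      by (rule second_difference_bound[OF f])
    also have "\<dots> = B * (h k)\<^sup>2"
      unfolding B_def by (simp add: power_mult_distrib algebra_simps)
    finally show ?thesis
      unfolding D_def using h(1)[of k] by (simp add: divide_le_eq)
  qed
  \<comment> \<open>A difference along 2a' is the sum of two differences along a', likewise for b';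
    the four terms share the factor 4 between the squared scales.\<close>
  have avg: "D k x = (D (Suc k) x + D (Suc k) (x + h (Suc k) *\<^sub>R a) + D (Suc k) (x + h (Suc k) *\<^sub>R b)
      + D (Suc k) (x + (h (Suc k) *\<^sub>R a + h (Suc k) *\<^sub>R b))) / 4" for k x
  proof -
    define a' where "a' = h (Suc k) *\<^sub>R a"
    define b' where "b' = h (Suc k) *\<^sub>R b"
    have e: "h k *\<^sub>R a = a' + a'" "h k *\<^sub>R b = b' + b'"
      unfolding a'_def b'_def h(3)[of k] by (simp_all flip: scaleR_add_left)
    have "(h k)\<^sup>2 = 4 * (h (Suc k))\<^sup>2" unfolding h(3)[of k] by (simp add: power_mult_distrib)
    then show ?thesis
      unfolding D_def e a'_def[symmetric] b'_def[symmetric] fdiff_def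
      by (simp add: add_divide_distrib diff_divide_distrib add_ac)
  qed
  have R: "r \<le> R k" "R k \<le> r + d" "R (Suc k) = R k + d * h (Suc k)" for k
    using h[of k] d0 mult_left_mono[OF h(2), of d k] unfolding R_def by (auto simp: algebra_simps)
  \<comment> \<open>The variance inequality integrated over the cube. The pair kept differs by the
    translation along \<open>a\<close>, so the gain is the third difference
    \<open>T\<close>.\<close>
  have step: "I k + integral (cube r) (\<lambda>x. (T (Suc k) x)\<^sup>2) / 16 \<le> I (Suc k)" for k
  proof -
    let ?h = "h (Suc k)" and ?D = "\<lambda>s x. (D (Suc k) (x + s))\<^sup>2"
    have int: "?D s integrable_on cube (R k)" for s
      by (intro integrable_on_cube continuous_intros contDs)
    have intT: "(\<lambda>x. (T (Suc k) x)\<^sup>2) integrable_on cube t" for t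
      by (intro integrable_on_cube continuous_intros contT)
    define J where "J s = integral (cube (R k)) (?D s)" for s
    have le: "J s \<le> I (Suc k)" if "norm s \<le> d * ?h" for s
      unfolding I_def R(3) J_def
      by (rule integral_cube_shift_le[OF _ _ that]) (auto intro!: continuous_intros contD)
    have n: "norm (?h *\<^sub>R a) \<le> d * ?h" "norm (?h *\<^sub>R b) \<le> d * ?h"
        "norm (?h *\<^sub>R a + ?h *\<^sub>R b) \<le> d * ?h" "norm (0::'a) \<le> d * ?h"
      using h(1)[of "Suc k"] norm_triangle_ineq[of "?h *\<^sub>R a" "?h *\<^sub>R b"]
      by (auto simp: d_def algebra_simps)
    have "integral (cube r) (\<lambda>x. (T (Suc k) x)\<^sup>2) \<le> integral (cube (R k)) (\<lambda>x. (T (Suc k) x)\<^sup>2)"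
      using R(1)[of k] by (intro integral_subset_le intT) (force simp: mem_cube)+
    moreover have "I k + integral (cube (R k)) (\<lambda>x. (T (Suc k) x)\<^sup>2) / 16
       = integral (cube (R k)) (\<lambda>x. (D k x)\<^sup>2 + (T (Suc k) x)\<^sup>2 / 16)"
      unfolding I_def using intT
      by (subst integral_add) (auto intro!: integrable_on_cube continuous_intros contD contT)
    moreover have "\<dots> \<le> integral (cube (R k)) (\<lambda>x. (?D 0 x + ?D (?h *\<^sub>R a) x + ?D (?h *\<^sub>R b) x + ?D (?h *\<^sub>R a + ?h *\<^sub>R b) x) / 4)"
    proof (rule integral_le)
      show "(\<lambda>x. (D k x)\<^sup>2 + (T (Suc k) x)\<^sup>2 / 16) integrable_on cube (R k)"
        by (auto intro!: integrable_on_cube continuous_intros contD contT)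
      show "(\<lambda>x. (?D 0 x + ?D (?h *\<^sub>R a) x + ?D (?h *\<^sub>R b) x + ?D (?h *\<^sub>R a + ?h *\<^sub>R b) x) / 4) integrable_on cube (R k)"
        by (intro integrable_on_cube continuous_intros contDs) auto
      show "(D k x)\<^sup>2 + (T (Suc k) x)\<^sup>2 / 16 \<le> (?D 0 x + ?D (?h *\<^sub>R a) x + ?D (?h *\<^sub>R b) x + ?D (?h *\<^sub>R a + ?h *\<^sub>R b) x) / 4" for x
        unfolding avg[of k x] T_eq using mean_square_four_le by simp
    qed
    moreover have "\<dots> = (J 0 + J (?h *\<^sub>R a) + J (?h *\<^sub>R b) + J (?h *\<^sub>R a + ?h *\<^sub>R b)) / 4"
      by (simp only: J_def integral_divide integral_add integrable_add int)
    moreover have "\<dots> \<le> I (Suc k)"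
    proof -
      have "(p + q + s + t) / 4 \<le> i" if "p \<le> i" "q \<le> i" "s \<le> i" "t \<le> i" for p q s t i :: real
        using add_mono[OF add_mono[OF add_mono[OF that(1,2)] that(3)] that(4)] by (simp add: divide_le_eq)
      then show ?thesis using le n by blast
    qed
    ultimately show ?thesis by linarith
  qed
  have T0: "integral (cube r) (\<lambda>x. (T k x)\<^sup>2) \<ge> 0" for k
    by (intro integral_nonneg integrable_on_cube continuous_intros contT) auto
  have "I k \<le> integral (cube (r + d)) (\<lambda>x::'a. B\<^sup>2)" for k
  proof -
    have "I k \<le> integral (cube (r + d)) (\<lambda>x. (D k x)\<^sup>2)"
      unfolding I_def using R(2)[of k]
      by (intro integral_subset_le integrable_on_cube continuous_intros contD) (force simp: mem_cube)+
    also have "\<dots> \<le> integral (cube (r + d)) (\<lambda>x::'a. B\<^sup>2)"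
    proof (intro integral_le integrable_on_cube continuous_intros contD)
      show "(D k x)\<^sup>2 \<le> B\<^sup>2" for x using power_mono[OF bound[of k x], of 2] by simp
    qed
    finally show ?thesis .
  qed
  moreover have "incseq I"
  proof (rule incseq_SucI)
    show "I k \<le> I (Suc k)" for k using step[of k] T0[of "Suc k"] by linarith
  qed
  \<comment> \<open>A bounded increasing sequence converges, so its increments vanish, and they
    dominate the integrals of the squares of \<open>T\<close>.\<close>
  ultimately obtain l where l: "I \<longlonglongrightarrow> l"
    using incseq_convergent by blast
  have "(\<lambda>k. 16 * (I (Suc k) - I k)) \<longlonglongrightarrow> 16 * (l - l)"
    by (intro tendsto_intros l LIMSEQ_Suc)
  then have lim: "(\<lambda>k. 16 * (I (Suc k) - I k)) \<longlonglongrightarrow> 0" by simp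
  have "(\<lambda>k. integral (cube r) (\<lambda>x. (T (Suc k) x)\<^sup>2)) \<longlonglongrightarrow> 0"
  proof (rule tendsto_sandwich[OF _ _ tendsto_const lim])
    show "\<forall>\<^sub>F k in sequentially. integral (cube r) (\<lambda>x. (T (Suc k) x)\<^sup>2) \<le> 16 * (I (Suc k) - I k)"
    proof (intro always_eventually allI)
      show "integral (cube r) (\<lambda>x. (T (Suc k) x)\<^sup>2) \<le> 16 * (I (Suc k) - I k)" for k
        using step[of k] by (simp add: field_simps)
    qed
  qed (use T0 in auto)
  then show ?thesis
    unfolding T_def[symmetric] by (rule LIMSEQ_imp_Suc)
qed

text \<open>Chebyshev's inequality: the superlevel sets are compact, cover \<open>K\<close>, and
  have measure at most the integral divided by \<kappa>. Working with outer covers lets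
  \<open>K\<close> be an arbitrary set.\<close>

lemma negligible_superlevel_limit:
  fixes g :: "nat \<Rightarrow> 'a::euclidean_space \<Rightarrow> real"
  assumes g: "\<And>k. continuous_on UNIV (g k)" "\<And>k x. 0 \<le> g k x"
    and lim: "(\<lambda>k. integral (cube r) (g k)) \<longlonglongrightarrow> 0"
    and K: "\<And>k. k \<ge> k0 \<Longrightarrow> K \<subseteq> {x \<in> cube r. \<kappa> \<le> g k x}" and "\<kappa> > 0"
  shows "negligible K"
  unfolding negligible_outer_le
proof (intro allI impI)
  fix e :: real assume "e > 0"
  then have "\<forall>\<^sub>F k in sequentially. integral (cube r) (g k) < e * \<kappa>"
    using lim \<open>\<kappa> > 0\<close> by (intro order_tendstoD) auto
  then obtain k where k: "k \<ge> k0" "integral (cube r) (g k) < e * \<kappa>"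
    unfolding eventually_sequentially by (meson nle_le)
  define S where "S = {x \<in> cube r. \<kappa> \<le> g k x}"
  have "compact S"
  proof -
    have "closed {x. \<kappa> \<le> g k x}"
      using g(1) by (intro closed_Collect_le continuous_intros)
    then have "compact (cube r \<inter> {x. \<kappa> \<le> g k x})"
      unfolding cube_def by (intro compact_Int_closed compact_cbox)
    then show ?thesis unfolding S_def Collect_conj_eq by simp
  qed
  then have S: "S \<in> lmeasurable" by (rule lmeasurable_compact)
  have "\<kappa> * measure lebesgue S = integral S (\<lambda>x. \<kappa> * 1)"
    using S by (simp only: integral_mult_right lmeasure_integral)
  also have "\<dots> = integral (cube r) (\<lambda>x. if x \<in> S then \<kappa> * 1 else 0)"
    by (subst integral_restrict_Int) (simp add: S_def Int_def conj_commute cong: conj_cong)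
  also have "\<dots> \<le> integral (cube r) (g k)"
  proof (rule integral_le)
    show "(\<lambda>x. if x \<in> S then \<kappa> * 1 else 0) integrable_on cube r"
      unfolding integrable_restrict_Int
      using S by (intro integrable_on_const) (simp add: S_def Int_def conj_commute cong: conj_cong)
  qed (use g(2) integrable_on_cube[OF g(1)] in \<open>auto simp: S_def\<close>)
  finally have "measure lebesgue S \<le> e"
    using k(2) mult_right_le_imp_le[OF _ \<open>\<kappa> > 0\<close>, of "measure lebesgue S" e] by (simp add: mult.commute)
  then show "\<exists>T. K \<subseteq> T \<and> T \<in> lmeasurable \<and> measure lebesgue T \<le> e"
    using K[OF k(1)] S unfolding S_def by blast
qed

section \<open>Approximation by quadratic polynomials\<close>

text \<open>Otherwise, at every fine scale, the sum \<open>g\<close> of the squares of all the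
  listed third differences would be at least \<kappa>^2 on \<open>K\<close>, while its integral
  tends to 0, which would make \<open>K\<close> negligible.\<close>

lemma third_differences_small_point:
  fixes f :: "'a::euclidean_space \<Rightarrow> real"
  assumes f: "semiconvex c f" "semiconvex c (\<lambda>x. - f x)"
    and K: "bounded K" "\<not> negligible K" and fin: "finite P" "finite Z" and \<kappa>: "\<kappa> > 0"
  shows "\<exists>k\<ge>k0. \<exists>x\<in>K. \<forall>(a, b)\<in>P. \<forall>z\<in>Z.
    \<bar>fdiff ((1/2)^k *\<^sub>R a) (fdiff ((1/2)^k *\<^sub>R a) (fdiff ((1/2)^k *\<^sub>R b) f)) (x + (1/2)^k *\<^sub>R z) / ((1/2)^k)\<^sup>2\<bar> < \<kappa>"
proof (rule ccontr)
  assume neg: "\<not> ?thesis"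
  define T where "T k a b x = fdiff ((1/2)^k *\<^sub>R a) (fdiff ((1/2)^k *\<^sub>R a) (fdiff ((1/2)^k *\<^sub>R b) f)) x / ((1/2)^k)\<^sup>2"
    for k :: nat and a b x
  define g where "g k x = (\<Sum>q\<in>P \<times> Z. (T k (fst (fst q)) (snd (fst q)) (x + (1/2)^k *\<^sub>R snd q))\<^sup>2)" for k :: nat and x
  have contT: "continuous_on UNIV (\<lambda>x. T k a b (x + s))" for k a b s
  proof -
    have cont: "continuous_on UNIV f" using f semiconvex_continuous by blast
    have contf: "continuous_on UNIV (\<lambda>x. f (x + s))" for s
      by (rule continuous_on_compose2[OF cont]) (auto intro!: continuous_intros)
    show ?thesis unfolding T_def fdiff_def add.assoc by (intro continuous_intros contf cont) auto
  qed
  obtain r0 where r0: "\<And>x. x \<in> K \<Longrightarrow> norm x \<le> r0" using K(1) by (auto simp: bounded_iff)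
  obtain d where d: "\<And>z. z \<in> Z \<Longrightarrow> norm z \<le> d" using finite_imp_bounded[OF fin(2)] by (auto simp: bounded_iff)
  have Kcube: "K \<subseteq> cube r0"
    using order_trans[OF Basis_le_norm r0] by (auto simp: mem_cube)
  have "negligible K"
  proof (rule negligible_superlevel_limit)
    show "continuous_on UNIV (g k)" for k
      unfolding g_def by (intro continuous_intros contT)
    show "0 \<le> g k x" for k x unfolding g_def by (intro sum_nonneg) auto
    have int: "(\<lambda>x. (T k a b (x + s))\<^sup>2) integrable_on cube r" for k a b s r
      by (intro integrable_on_cube continuous_intros contT)
    have "(\<lambda>k. integral (cube r0) (\<lambda>x. (T k a b (x + (1/2)^k *\<^sub>R z))\<^sup>2)) \<longlonglongrightarrow> 0" if "z \<in> Z" for a b z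
    proof (rule tendsto_sandwich[OF _ _ tendsto_const])
      show "(\<lambda>k. integral (cube (r0 + d)) (\<lambda>x. (T k a b x)\<^sup>2)) \<longlonglongrightarrow> 0"
        unfolding T_def by (rule third_difference_L2_tendsto_0[OF f])
      show "\<forall>\<^sub>F k in sequentially. 0 \<le> integral (cube r0) (\<lambda>x. (T k a b (x + (1/2)^k *\<^sub>R z))\<^sup>2)"
        by (intro always_eventually allI integral_nonneg int) auto
      have "norm ((1/2)^k *\<^sub>R z) \<le> d" for k :: nat
      proof -
        have "norm ((1/2)^k *\<^sub>R z) \<le> 1 * norm z"
          unfolding norm_scaleR by (intro mult_right_mono) (auto simp: power_le_one)
        then show ?thesis using d[OF that] by simp
      qed
      then show "\<forall>\<^sub>F k in sequentially. integral (cube r0) (\<lambda>x. (T k a b (x + (1/2)^k *\<^sub>R z))\<^sup>2)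
          \<le> integral (cube (r0 + d)) (\<lambda>x. (T k a b x)\<^sup>2)"
        using contT[of _ a b 0]
        by (intro always_eventually allI integral_cube_shift_le continuous_intros) auto
    qed
    then have "(\<lambda>k. \<Sum>q\<in>P \<times> Z. integral (cube r0) (\<lambda>x. (T k (fst (fst q)) (snd (fst q)) (x + (1/2)^k *\<^sub>R snd q))\<^sup>2))
        \<longlonglongrightarrow> (\<Sum>q\<in>P \<times> Z. 0)"
      by (intro tendsto_sum) auto
    then show "(\<lambda>k. integral (cube r0) (g k)) \<longlonglongrightarrow> 0"
      unfolding g_def using fin int by (simp add: integral_sum)
    show "K \<subseteq> {x \<in> cube r0. \<kappa>\<^sup>2 \<le> g k x}" if "k \<ge> k0" for k
    proof
      fix x assume x: "x \<in> K"
      have "\<not> (\<forall>(a, b)\<in>P. \<forall>z\<in>Z. \<bar>T k a b (x + (1/2)^k *\<^sub>R z)\<bar> < \<kappa>)"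
        using neg that x unfolding T_def by blast
      then obtain a b z where abz: "(a, b) \<in> P" "z \<in> Z" "\<not> \<bar>T k a b (x + (1/2)^k *\<^sub>R z)\<bar> < \<kappa>"
        by (auto simp del: not_less)
      have "\<kappa>\<^sup>2 \<le> (T k a b (x + (1/2)^k *\<^sub>R z))\<^sup>2"
        using abz(3) \<kappa> by (simp add: abs_le_square_iff[symmetric])
      also have "\<dots> \<le> g k x"
        unfolding g_def using member_le_sum[of "((a, b), z)" "P \<times> Z"
            "\<lambda>q. (T k (fst (fst q)) (snd (fst q)) (x + (1/2)^k *\<^sub>R snd q))\<^sup>2"] abz fin by auto
      finally show "x \<in> {x \<in> cube r0. \<kappa>\<^sup>2 \<le> g k x}" using x Kcube by auto
    qed
  qed (use \<kappa> in auto)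
  then show False using K(2) by simp
qed

text \<open>The mean-square decay covers only differences with a repeated step. The identity (a+b)^2
  - a^2 - b^2 = 2ab, with base points adjusted, recovers the fully mixed ones.\<close>

lemma fdiff_polarization:
  "2 * fdiff a (fdiff b (fdiff c F)) (y + b) =
    fdiff (a + b) (fdiff (a + b) (fdiff c F)) y - fdiff a (fdiff a (fdiff c F)) (y + b + b) - fdiff b (fdiff b (fdiff c F)) y"
  unfolding fdiff_def by (simp add: add_ac)

section \<open>Quadratic polynomials and discrete Taylor expansion\<close>

definition quad :: "real \<Rightarrow> real^'n \<Rightarrow> real^'n^'n \<Rightarrow> real^'n \<Rightarrow> real" where
  "quad c p A y = c + p \<bullet> y + y \<bullet> (A *v y) / 2"

lemma quad_scale: "h\<^sup>2 * quad c p A (v /\<^sub>R h) = quad (h\<^sup>2 * c) (h *\<^sub>R p) A v" if "h \<noteq> 0"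
  using that unfolding quad_def by (simp add: matrix_vector_mult_scaleR power2_eq_square field_simps)

lemma symmetric_inner_commute:
  fixes A :: "real^'n^'n"
  assumes "transpose A = A"
  shows "x \<bullet> (A *v y) = y \<bullet> (A *v x)"
  by (metis assms dot_lmul_matrix inner_commute vector_transpose_matrix)

lemma semiconvex_quad:
  fixes A :: "real^'n^'n"
  assumes "\<And>y. - (y \<bullet> (A *v y)) \<le> c * (norm y)\<^sup>2"
  shows "semiconvex c (quad k p A)"
  unfolding semiconvex_def
proof (intro allI impI)
  fix x y :: "real^'n" and t :: real assume t: "0 \<le> t" "t \<le> 1"
  have "quad k p A ((1 - t) *\<^sub>R x + t *\<^sub>R y) = (1 - t) * quad k p A x + t * quad k p A y
    + t * (1 - t) * (- ((x - y) \<bullet> (A *v (x - y)))) / 2"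
    unfolding quad_def matrix_vector_right_distrib matrix_vector_mult_diff_distrib
      matrix_vector_mult_scaleR inner_simps
    by (simp add: field_simps)
  also have "t * (1 - t) * (- ((x - y) \<bullet> (A *v (x - y)))) \<le> t * (1 - t) * (c * (norm (x - y))\<^sup>2)"
    using t by (intro mult_left_mono assms) auto
  finally show "quad k p A ((1 - t) *\<^sub>R x + t *\<^sub>R y) \<le> (1 - t) * quad k p A x + t * quad k p A y
      + c / 2 * (t * (1 - t)) * (norm (x - y))\<^sup>2"
    by (simp add: mult_ac)
qed

text \<open>Natural coordinates allow induction on the coordinate sum; a cube around a given point
  is first moved into the nonnegative orthant.\<close>

definition lat :: "('n::finite \<Rightarrow> nat) \<Rightarrow> real^'n" where
  "lat z = (\<chi> i. real (z i))"

lemma lat_step: "lat (z(k := Suc (z k))) = lat z + axis k 1"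
  by (auto simp: lat_def vec_eq_iff axis_def)

text \<open>A discrete Taylor formula: the polynomial has the same value and the same first and
  second differences at 0 as \<open>F\<close>, so the remainder \<open>G\<close> is driven by third
  differences alone.\<close>

lemma lattice_near_quadratic:
  fixes F :: "real^'n \<Rightarrow> real"
  assumes third: "\<And>z i j k. sum z UNIV \<le> L \<Longrightarrow>
    \<bar>fdiff (axis i 1) (fdiff (axis j 1) (fdiff (axis k 1) F)) (lat z)\<bar> \<le> \<kappa>"
  obtains c p A where "transpose A = A" "\<And>i j. A $ i $ j = fdiff (axis i 1) (fdiff (axis j 1) F) 0"
    "\<And>z. sum z UNIV \<le> L \<Longrightarrow> \<bar>F (lat z) - quad c p A (lat z)\<bar> \<le> \<kappa> * real L ^ 3"
proof -
  define A :: "real^'n^'n" where "A = (\<chi> i j. fdiff (axis i 1) (fdiff (axis j 1) F) 0)"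
  \<comment> \<open>The first difference of the quadratic part along an axis is half the diagonal
    entry, which has to be subtracted.\<close>
  define p :: "real^'n" where "p = (\<chi> i. fdiff (axis i 1) F 0 - A $ i $ i / 2)"
  define G where "G y = F y - quad (F 0) p A y" for y
  have A: "A $ i $ j = fdiff (axis i 1) (fdiff (axis j 1) F) 0" for i j
    by (simp add: A_def)
  have tr: "transpose A = A"
    by (auto simp: vec_eq_iff transpose_def A fdiff_def add_ac)
  have Aij: "axis i 1 \<bullet> (A *v axis j 1) = A $ i $ j" for i j
    by (simp add: inner_axis' matrix_vector_mult_basis column_def)
  have d1: "fdiff (axis i 1) (quad k p A) y = p $ i + axis i 1 \<bullet> (A *v y) + A $ i $ i / 2" for i k y
    using symmetric_inner_commute[OF tr, of y "axis i 1"] Aij[of i i]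
    unfolding fdiff_def quad_def matrix_vector_right_distrib inner_simps
    by (simp add: inner_axis field_simps)
  have d2: "fdiff (axis i 1) (fdiff (axis j 1) (quad k p A)) y = A $ i $ j" for i j k y
    using Aij[of j i] tr unfolding fdiff_def[of "axis i 1"] d1 matrix_vector_right_distrib inner_simps
    by (simp add: transpose_def vec_eq_iff)
  have G_eq: "G = (\<lambda>y. F y - quad (F 0) p A y)" by (simp add: G_def fun_eq_iff)
  have fdiff_minus: "fdiff a (\<lambda>y. f y - g y) = (\<lambda>y. fdiff a f y - fdiff a g y)" for a :: "real^'n" and f g
    by (simp add: fdiff_def fun_eq_iff)
  have G3: "\<bar>fdiff (axis k 1) (fdiff (axis i 1) (fdiff (axis j 1) G)) (lat z)\<bar> \<le> \<kappa>" if "sum z UNIV \<le> L" for i j k z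
    using third[OF that, of k i j] unfolding G_eq fdiff_minus
    by (simp add: fdiff_def[of "axis k 1" "fdiff (axis i 1) (fdiff (axis j 1) (quad (F 0) p A))"] d2)
  have zero: "lat (\<lambda>_. 0) = (0::real^'n)" by (simp add: lat_def vec_eq_iff)
  have G0: "G 0 = 0" "fdiff (axis i 1) G 0 = 0" "fdiff (axis i 1) (fdiff (axis j 1) G) 0 = 0" for i j
  proof -
    show "G 0 = 0" by (simp add: G_eq quad_def)
    show "fdiff (axis i 1) G 0 = 0" unfolding G_eq fdiff_minus d1 by (simp add: p_def)
    show "fdiff (axis i 1) (fdiff (axis j 1) G) 0 = 0" unfolding G_eq fdiff_minus d2 by (simp add: A)
  qed
  have \<kappa>: "\<kappa> \<ge> 0" using third[of "\<lambda>_. 0"] by (force intro: order_trans[OF abs_ge_zero])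
  \<comment> \<open>Induction along a lattice path from 0. A unit step changes each difference by
    one of the next order, so the bounds of order n, n^2 and n^3 must be carried together.\<close>
  have main: "(\<forall>i j. \<bar>fdiff (axis i 1) (fdiff (axis j 1) G) (lat z)\<bar> \<le> \<kappa> * real n)
     \<and> (\<forall>i. \<bar>fdiff (axis i 1) G (lat z)\<bar> \<le> \<kappa> * real n ^ 2) \<and> \<bar>G (lat z)\<bar> \<le> \<kappa> * real n ^ 3"
    if "sum z UNIV = n" "n \<le> L" for z n
    using that
  proof (induction n arbitrary: z)
    case 0
    then have "z = (\<lambda>_. 0)" by auto
    then show ?case using G0 by (simp add: zero)
  next
    case (Suc n)
    then obtain k where k: "z k > 0"
      by (metis sum.neutral not_gr_zero nat.simps(3))
    define z' where "z' = z(k := z k - 1)"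
    have z: "z = z'(k := Suc (z' k))" using k by (auto simp: z'_def)
    have "sum z UNIV = Suc (sum z' UNIV)"
    proof -
      have "sum z UNIV = z k + sum z (UNIV - {k})" "sum z' UNIV = z' k + sum z' (UNIV - {k})"
        by (auto intro: sum.remove)
      moreover have "sum z' (UNIV - {k}) = sum z (UNIV - {k})"
        by (intro sum.cong) (auto simp: z'_def)
      ultimately show ?thesis using k by (simp add: z'_def)
    qed
    then have s: "sum z' UNIV = n" "n \<le> L" using Suc.prems by auto
    have IH1: "\<bar>fdiff (axis i 1) (fdiff (axis j 1) G) (lat z')\<bar> \<le> \<kappa> * real n"
      and IH2: "\<bar>fdiff (axis i 1) G (lat z')\<bar> \<le> \<kappa> * real n ^ 2"
      and IH3: "\<bar>G (lat z')\<bar> \<le> \<kappa> * real n ^ 3" for i j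
      using Suc.IH[OF s] by auto
    have shift: "f (lat z) = f (lat z') + fdiff (axis k 1) f (lat z')" for f
      unfolding fdiff_def z lat_step by simp
    have n1: "real n ^ 2 + real n \<le> real (Suc n) ^ 2" "real n ^ 3 + real n ^ 2 \<le> real (Suc n) ^ 3"
      by (simp_all add: power2_eq_square power3_eq_cube algebra_simps)
    have 1: "\<bar>fdiff (axis i 1) (fdiff (axis j 1) G) (lat z)\<bar> \<le> \<kappa> * real (Suc n)" for i j
      using IH1[of i j] G3[of z' k i j] s shift[of "fdiff (axis i 1) (fdiff (axis j 1) G)"]
      by (simp add: algebra_simps)
    have 2: "\<bar>fdiff (axis i 1) G (lat z)\<bar> \<le> \<kappa> * real (Suc n) ^ 2" for i
      using IH2[of i] IH1[of k i] shift[of "fdiff (axis i 1) G"] mult_left_mono[OF n1(1) \<kappa>]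
      unfolding distrib_left by linarith
    have 3: "\<bar>G (lat z)\<bar> \<le> \<kappa> * real (Suc n) ^ 3"
      using IH3 IH2[of k] shift[of G] mult_left_mono[OF n1(2) \<kappa>]
      unfolding distrib_left by linarith
    show ?case using 1 2 3 by blast
  qed
  have "\<bar>F (lat z) - quad (F 0) p A (lat z)\<bar> \<le> \<kappa> * real L ^ 3" if "sum z UNIV \<le> L" for z
  proof -
    have "\<bar>G (lat z)\<bar> \<le> \<kappa> * real (sum z UNIV) ^ 3" using main[OF refl that] by blast
    also have "\<dots> \<le> \<kappa> * real L ^ 3" using that \<kappa> by (intro mult_left_mono power_mono) (auto simp del: of_nat_sum)
    finally show ?thesis by (simp add: G_def)
  qed
  with that tr A show thesis by blast
qed

text \<open>On a unit cell, \<open>G\<close> plus c/2 times the squared distance to the lowest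
  corner is convex, hence largest at a corner; the added square is at most the squared diagonal of
  the cell, which is the dimension.\<close>

lemma semiconvex_le_lattice_bound:
  fixes G :: "real^'n \<Rightarrow> real"
  assumes G: "semiconvex c G" and "c \<ge> 0"
    and b: "\<And>z. sum z UNIV \<le> (m + 1) * CARD('n) \<Longrightarrow> G (lat z) \<le> b"
    and y: "\<And>i. 0 \<le> y $ i" "\<And>i. y $ i \<le> real m"
  shows "G y \<le> b + c / 2 * CARD('n)"
proof -
  define z where "z i = nat \<lfloor>y $ i\<rfloor>" for i
  define H where "H x = G (lat z + x) + c / 2 * (norm x)\<^sup>2" for x
  have "semiconvex c (\<lambda>x. G (lat z + 1 *\<^sub>R x) / 1\<^sup>2)"
    by (rule semiconvex_rescale[OF G]) simp
  then have "convex_on UNIV H"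
    unfolding H_def semiconvex_iff_convex_on[where a = 0] by simp
  define V where "V = {x::real^'n. \<forall>i\<in>Basis. x \<bullet> i = 0 \<or> x \<bullet> i = 1}"
  have "H x \<le> b + c / 2 * CARD('n)" if "x \<in> V" for x
  proof -
    have x: "x $ i = 0 \<or> x $ i = 1" for i
      using that[unfolded V_def] by (auto simp: Basis_vec_def inner_axis)
    define z' where "z' i = z i + nat \<lfloor>x $ i\<rfloor>" for i
    \<comment> \<open>A coordinate of \<open>y\<close> equal to \<open>m\<close> has a cell reaching
      up to m + 1; hence the range of \<open>z\<close> in the hypothesis.\<close>
    have le: "z' i \<le> m + 1" for i
    proof -
      have "\<lfloor>y $ i\<rfloor> \<le> int m" using y(2)[of i] by linarith
      moreover have "nat \<lfloor>x $ i\<rfloor> \<le> 1" using x[of i] by auto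
      ultimately show ?thesis unfolding z'_def z_def by linarith
    qed
    have "sum z' UNIV \<le> (m + 1) * CARD('n)"
      using sum_bounded_above[of UNIV z' "m + 1"] le by (simp add: mult.commute)
    moreover have "lat z' = lat z + x"
    proof -
      have "real (nat \<lfloor>x $ i\<rfloor>) = x $ i" for i using x[of i] by auto
      then show ?thesis by (simp add: lat_def z'_def vec_eq_iff)
    qed
    ultimately have "G (lat z + x) \<le> b" using b[of z'] by simp
    moreover have "(norm x)\<^sup>2 \<le> CARD('n)"
    proof -
      have "(norm x)\<^sup>2 = (\<Sum>i\<in>UNIV. (x $ i)\<^sup>2)"
        by (simp add: norm_vec_def L2_set_def sum_nonneg)
      also have "\<dots> \<le> (\<Sum>i\<in>(UNIV::'n set). 1)"
      proof (rule sum_mono)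
        show "(x $ i)\<^sup>2 \<le> 1" for i using x[of i] by auto
      qed
      finally show ?thesis by simp
    qed
    then have "c / 2 * (norm x)\<^sup>2 \<le> c / 2 * CARD('n)"
      using \<open>c \<ge> 0\<close> by (intro mult_left_mono) auto
    ultimately show ?thesis unfolding H_def by linarith
  qed
  moreover have "convex_on (convex hull V) H"
    using \<open>convex_on UNIV H\<close> by (rule convex_on_subset) auto
  ultimately have hull: "\<forall>x\<in>convex hull V. H x \<le> b + c / 2 * CARD('n)"
    by (intro convex_on_convex_hull_bound) auto
  have "y - lat z \<in> cbox 0 One"
    unfolding mem_box
  proof (intro ballI)
    fix i :: "real^'n" assume "i \<in> Basis"
    then obtain j where j: "i = axis j 1" by (auto simp: Basis_vec_def)
    have "0 \<le> y $ j - real (nat \<lfloor>y $ j\<rfloor>)" "y $ j - real (nat \<lfloor>y $ j\<rfloor>) \<le> 1"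
      using y(1)[of j] by linarith+
    moreover have "One \<bullet> i = 1" using \<open>i \<in> Basis\<close> by simp
    moreover have "(y - lat z) \<bullet> i = y $ j - real (nat \<lfloor>y $ j\<rfloor>)"
      by (simp only: j lat_def z_def inner_axis vector_minus_component vec_lambda_beta) simp
    ultimately show "0 \<bullet> i \<le> (y - lat z) \<bullet> i \<and> (y - lat z) \<bullet> i \<le> One \<bullet> i"
      by simp
  qed
  then have "H (y - lat z) \<le> b + c / 2 * CARD('n)"
    using hull unfolding V_def unit_interval_convex_hull by blast
  moreover have "G y \<le> H (y - lat z)" unfolding H_def using \<open>c \<ge> 0\<close> by simp
  ultimately show ?thesis by linarith
qed

lemma finite_sum_le: "finite {z :: 'n::finite \<Rightarrow> nat. sum z UNIV \<le> L}"
proof (rule finite_subset)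
  show "{z :: 'n \<Rightarrow> nat. sum z UNIV \<le> L} \<subseteq> PiE UNIV (\<lambda>_. {..L})"
  proof
    fix z :: "'n \<Rightarrow> nat" assume "z \<in> {z. sum z UNIV \<le> L}"
    then have "z i \<le> L" for i using member_le_sum[of i UNIV z] by simp
    then show "z \<in> PiE UNIV (\<lambda>_. {..L})" by (simp add: PiE_def)
  qed
  show "finite (PiE (UNIV::'n set) (\<lambda>_. {..L}))" by (rule finite_PiE) simp_all
qed

lemma fdiff_rescale:
  fixes f :: "'a::real_vector \<Rightarrow> real"
  shows "fdiff a (fdiff b (fdiff d (\<lambda>y. f (x + h *\<^sub>R y) / k))) y =
    fdiff (h *\<^sub>R a) (fdiff (h *\<^sub>R b) (fdiff (h *\<^sub>R d) f)) (x + h *\<^sub>R y) / k"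
  unfolding fdiff_def by (simp add: scaleR_add_right diff_divide_distrib add.assoc)

lemma uminus_matrix_vector:
  fixes A :: "real^'n^'n"
  shows "(- A) *v x = - (A *v x)"
  by (simp add: vec_eq_iff matrix_vector_mult_def sum_negf)

lemma quadratic_form_bound:
  fixes A :: "real^'n^'n"
  assumes "\<And>i j. \<bar>A $ i $ j\<bar> \<le> c"
  shows "\<bar>y \<bullet> (A *v y)\<bar> \<le> c * (real CARD('n))\<^sup>2 * (norm y)\<^sup>2"
proof -
  have c: "c \<ge> 0" using order_trans[OF abs_ge_zero assms[of undefined undefined]] .
  have "\<bar>y \<bullet> (A *v y)\<bar> = \<bar>\<Sum>i\<in>UNIV. \<Sum>j\<in>UNIV. y $ i * (A $ i $ j * y $ j)\<bar>"
    by (simp add: inner_vec_def matrix_vector_mult_def sum_distrib_left)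
  also have "\<dots> \<le> (\<Sum>i\<in>(UNIV::'n set). \<Sum>j\<in>(UNIV::'n set). c * (norm y)\<^sup>2)"
  proof (intro order_trans[OF sum_abs] sum_mono)
    fix i j
    have "\<bar>y $ i\<bar> * (\<bar>A $ i $ j\<bar> * \<bar>y $ j\<bar>) \<le> norm y * (c * norm y)"
      using assms c by (intro mult_mono component_le_norm_cart) auto
    then show "\<bar>y $ i * (A $ i $ j * y $ j)\<bar> \<le> c * (norm y)\<^sup>2"
      by (simp add: abs_mult power2_eq_square mult_ac)
  qed
  also have "\<dots> = c * (real CARD('n))\<^sup>2 * (norm y)\<^sup>2" by (simp add: power2_eq_square)
  finally show ?thesis .
qed

text \<open>A substitute for Rademacher's theorem applied to the gradient: it suffices to be
  close to a quadratic polynomial at one small scale around a single point of \<open>K\<close>.\<close>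

lemma quadratic_approximation_point:
  fixes f :: "real^'n \<Rightarrow> real"
  assumes f: "semiconvex c f" "semiconvex c (\<lambda>x. - f x)"
    and K: "bounded K" "\<not> negligible K" and "\<eta> > 0" "r0 > 0"
  obtains x r x0 k p A where "x \<in> K" "0 < r" "r \<le> r0" "transpose A = A"
    "\<And>y. y \<in> cball x r \<Longrightarrow> \<bar>f y - quad k p A (y - x0)\<bar> \<le> \<eta> * r\<^sup>2"
proof -
  let ?N = "CARD('n)"
  have c: "c \<ge> 0"
    using order_trans[OF abs_ge_zero second_difference_bound[OF f, of "axis undefined 1" "axis undefined 1" 0]]
    by (simp add: norm_axis_1)
  \<comment> \<open>Semiconvexity constant of the zoomed function minus its polynomial:
    \<open>c\<close> for the function, the rest for the quadratic form.\<close>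
  define c' where "c' = c + c * (real ?N)\<^sup>2"
  have c': "c' \<ge> 0" unfolding c'_def using c by simp
  \<comment> \<open>The 1 is the error at lattice points, the other term the loss inside a
    cell.\<close>
  define E where "E = 1 + c' / 2 * ?N"
  have "E \<ge> 1" unfolding E_def using c' by simp
  \<comment> \<open>The error \<open>E\<close> on the zoomed cube does not depend on its half-side
    \<open>M\<close>, whereas the allowed error \<eta> r^2 with r = h M grows quadratically in
    \<open>M\<close>.\<close>
  obtain M :: nat where M: "M \<ge> 1" "E \<le> \<eta> * (real M)\<^sup>2"
  proof -
    obtain M0 :: nat where M0: "E / \<eta> < real M0" using reals_Archimedean2 by blast
    have "0 < E / \<eta>" using \<open>E \<ge> 1\<close> \<open>\<eta> > 0\<close> by simp
    then have "0 < real M0" using M0 by linarith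
    then have "M0 \<ge> 1" by (simp add: Suc_le_eq)
    then have "real M0 \<le> (real M0)\<^sup>2" by (simp add: power2_eq_square)
    then have "E / \<eta> \<le> (real M0)\<^sup>2" using M0 by linarith
    then show thesis using that[OF \<open>M0 \<ge> 1\<close>] \<open>\<eta> > 0\<close> by (simp add: field_simps)
  qed
  define L where "L = (2 * M + 1) * ?N"
  have "L \<ge> 1" unfolding L_def by (simp add: Suc_le_eq)
  \<comment> \<open>Polarisation will bound all third differences by 2 \<kappa>; this value makes
    the accumulated lattice error equal to 1.\<close>
  define \<kappa> where "\<kappa> = 1 / (2 * real L ^ 3)"
  have \<kappa>: "\<kappa> > 0" unfolding \<kappa>_def using \<open>L \<ge> 1\<close> by simp
  obtain k0 :: nat where k0: "(1/2) ^ k0 < r0 / M"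
    using real_arch_pow_inv[of "r0 / M" "1/2"] \<open>r0 > 0\<close> M(1) by auto
  define e :: "'n \<Rightarrow> real^'n" where "e i = axis i 1" for i
  \<comment> \<open>Polarisation asks for the repeated steps \<open>e i\<close> and
    \<open>e i + e j\<close> and for base points displaced by \<open>e j\<close> either way;
    \<open>P\<close> and \<open>Z\<close> list them all.\<close>
  define P where "P = (range e \<union> range (\<lambda>(i, j). e i + e j)) \<times> range e"
  \<comment> \<open>Moving the corner \<open>x - h *\<^sub>R w\<close> to the origin puts the cube
    around \<open>x\<close> into the range of \<open>lat\<close>.\<close>
  define w :: "real^'n" where "w = (\<chi> i. real M)"
  define Z where "Z = (\<lambda>(z, s). lat z - w + s) ` ({z. sum z UNIV \<le> L} \<times> (range e \<union> range (\<lambda>i. - e i)))"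
  have "finite P" "finite Z"
    unfolding P_def Z_def by (intro finite_imageI finite_cartesian_product finite_UnI finite_sum_le finite)+
  from third_differences_small_point[OF f K this \<kappa>, of k0]
  obtain k where k: "k \<ge> k0" and pt': "\<exists>x\<in>K. \<forall>(a, b)\<in>P. \<forall>z\<in>Z.
    \<bar>fdiff ((1/2)^k *\<^sub>R a) (fdiff ((1/2)^k *\<^sub>R a) (fdiff ((1/2)^k *\<^sub>R b) f)) (x + (1/2)^k *\<^sub>R z) / ((1/2)^k)\<^sup>2\<bar> < \<kappa>"
    by (elim exE conjE)
  obtain x where x: "x \<in> K" and small0: "\<forall>(a, b)\<in>P. \<forall>z\<in>Z.
    \<bar>fdiff ((1/2)^k *\<^sub>R a) (fdiff ((1/2)^k *\<^sub>R a) (fdiff ((1/2)^k *\<^sub>R b) f)) (x + (1/2)^k *\<^sub>R z) / ((1/2)^k)\<^sup>2\<bar> < \<kappa>"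
    using pt' by (elim bexE)
  have small: "\<bar>fdiff ((1/2)^k *\<^sub>R a) (fdiff ((1/2)^k *\<^sub>R a) (fdiff ((1/2)^k *\<^sub>R b) f)) (x + (1/2)^k *\<^sub>R z) / ((1/2)^k)\<^sup>2\<bar> < \<kappa>" if "(a, b) \<in> P" "z \<in> Z" for a b z
    using bspec[OF small0 that(1), unfolded prod.case] that(2) by (rule bspec)
  define h :: real where "h = (1/2)^k"
  have h: "h > 0" "h * M \<le> r0"
  proof -
    show "h > 0" by (simp add: h_def)
    have "h \<le> (1/2)^k0" unfolding h_def using k by (intro power_decreasing) auto
    then have "h \<le> r0 / M" using k0 by linarith
    then show "h * M \<le> r0" using M(1) by (simp add: field_simps)
  qed
  define x0 where "x0 = x - h *\<^sub>R w"
  define F where "F y = f (x0 + h *\<^sub>R y) / h\<^sup>2" for y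
  have F: "semiconvex c F" "semiconvex c (\<lambda>y. - F y)"
    unfolding F_def using semiconvex_rescale[OF f(1) h(1), of x0] semiconvex_rescale[OF f(2) h(1), of x0] by auto
  have small': "\<bar>fdiff a (fdiff a (fdiff (e l) F)) (lat z + s)\<bar> < \<kappa>"
    if "a \<in> range e \<union> range (\<lambda>(i, j). e i + e j)" "sum z UNIV \<le> L" "s \<in> range e \<union> range (\<lambda>i. - e i)" for a l z s
  proof -
    have "(a, e l) \<in> P" using that by (auto simp: P_def)
    moreover have "lat z - w + s \<in> Z" unfolding Z_def using that by force
    moreover have "x + h *\<^sub>R (lat z - w + s) = x0 + h *\<^sub>R (lat z + s)"
      unfolding x0_def by (simp add: algebra_simps)
    ultimately show ?thesis
      using small[of a "e l" "lat z - w + s"] unfolding F_def fdiff_rescale h_def[symmetric] by simp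
  qed
  have third: "\<bar>fdiff (axis i 1) (fdiff (axis j 1) (fdiff (axis l 1) F)) (lat z)\<bar> \<le> 2 * \<kappa>"
    if z: "sum z UNIV \<le> L" for z i j l
  proof -
    have "2 * fdiff (e i) (fdiff (e j) (fdiff (e l) F)) (lat z) =
      fdiff (e i + e j) (fdiff (e i + e j) (fdiff (e l) F)) (lat z + - e j)
      - fdiff (e i) (fdiff (e i) (fdiff (e l) F)) (lat z + e j)
      - fdiff (e j) (fdiff (e j) (fdiff (e l) F)) (lat z + - e j)"
      using fdiff_polarization[of "e i" "e j" "e l" F "lat z - e j"] by simp
    moreover have "\<bar>fdiff (e i + e j) (fdiff (e i + e j) (fdiff (e l) F)) (lat z + - e j)\<bar> < \<kappa>"
      by (rule small'[OF _ z]) auto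
    moreover have "\<bar>fdiff (e i) (fdiff (e i) (fdiff (e l) F)) (lat z + e j)\<bar> < \<kappa>"
      by (rule small'[OF _ z]) auto
    moreover have "\<bar>fdiff (e j) (fdiff (e j) (fdiff (e l) F)) (lat z + - e j)\<bar> < \<kappa>"
      by (rule small'[OF _ z]) auto
    ultimately have "\<bar>fdiff (e i) (fdiff (e j) (fdiff (e l) F)) (lat z)\<bar> \<le> 2 * \<kappa>" by linarith
    then show ?thesis by (simp add: e_def)
  qed
  obtain q p A where A: "transpose A = A" "\<And>i j. A $ i $ j = fdiff (axis i 1) (fdiff (axis j 1) F) 0"
    and close: "\<And>z. sum z UNIV \<le> L \<Longrightarrow> \<bar>F (lat z) - quad q p A (lat z)\<bar> \<le> 2 * \<kappa> * real L ^ 3"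
  proof (rule lattice_near_quadratic[OF third])
    fix q p A
    assume "transpose A = A" "\<And>i j. A $ i $ j = fdiff (axis i 1) (fdiff (axis j 1) F) 0"
      "\<And>z. sum z UNIV \<le> L \<Longrightarrow> \<bar>F (lat z) - quad q p A (lat z)\<bar> \<le> 2 * \<kappa> * real L ^ 3"
    then show thesis by (rule that)
  qed
  have close': "\<bar>F (lat z) - quad q p A (lat z)\<bar> \<le> 1" if "sum z UNIV \<le> (2 * M + 1) * ?N" for z
    using close[OF that[folded L_def]] \<open>L \<ge> 1\<close> by (simp add: \<kappa>_def)
  \<comment> \<open>The entries are second differences of the zoomed function, hence bounded by
    \<open>c\<close> at every scale; subtracting the polynomial keeps a semiconvexity constant
    independent of \<open>k\<close>.\<close>
  have "\<bar>A $ i $ j\<bar> \<le> c" for i j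
    unfolding A(2) using second_difference_bound[OF F, of "axis i 1" "axis j 1" 0] by (simp add: norm_axis_1)
  then have qb: "\<bar>y \<bullet> (A *v y)\<bar> \<le> c * (real ?N)\<^sup>2 * (norm y)\<^sup>2" for y
    by (rule quadratic_form_bound)
  have neg: "quad (- q) (- p) (- A) = (\<lambda>y. - quad q p A y)"
    by (simp add: fun_eq_iff quad_def uminus_matrix_vector)
  have "semiconvex (c * (real ?N)\<^sup>2) (quad (- q) (- p) (- A))" "semiconvex (c * (real ?N)\<^sup>2) (quad q p A)"
  proof (safe intro!: semiconvex_quad)
    fix y
    show "- (y \<bullet> (- A *v y)) \<le> c * (real ?N)\<^sup>2 * (norm y)\<^sup>2" "- (y \<bullet> (A *v y)) \<le> c * (real ?N)\<^sup>2 * (norm y)\<^sup>2"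
      using qb[of y] by (auto simp: abs_le_iff uminus_matrix_vector)
  qed
  then have sc: "semiconvex c' (\<lambda>y. F y + - quad q p A y)" "semiconvex c' (\<lambda>y. - F y + quad q p A y)"
    unfolding c'_def neg using semiconvex_add[OF F(1)] semiconvex_add[OF F(2)] by blast+
  have cube: "\<bar>F y - quad q p A y\<bar> \<le> E" if y: "\<And>i. 0 \<le> y $ i" "\<And>i. y $ i \<le> real (2 * M)" for y
  proof -
    have "F y + - quad q p A y \<le> E"
      unfolding E_def by (rule semiconvex_le_lattice_bound[OF sc(1) c' _ y]) (use close' in \<open>auto simp: abs_le_iff\<close>)
    moreover have "- F y + quad q p A y \<le> E"
      unfolding E_def by (rule semiconvex_le_lattice_bound[OF sc(2) c' _ y]) (use close' in \<open>auto simp: abs_le_iff\<close>)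
    ultimately show ?thesis by linarith
  qed
  have "\<bar>f y - quad (h\<^sup>2 * q) (h *\<^sub>R p) A (y - x0)\<bar> \<le> \<eta> * (h * M)\<^sup>2" if y: "y \<in> cball x (h * M)" for y
  proof -
    define v where "v = (y - x0) /\<^sub>R h"
    have vi: "v $ i = (y - x) $ i / h + M" for i
      unfolding v_def x0_def w_def using h(1) by (simp add: field_simps)
    have b: "\<bar>(y - x) $ i / h\<bar> \<le> M" for i
    proof -
      have "\<bar>(y - x) $ i\<bar> \<le> h * M"
        using component_le_norm_cart[of "y - x" i] y by (simp add: dist_norm norm_minus_commute)
      then show ?thesis using h(1) by (simp add: field_simps)
    qed
    have "0 \<le> v $ i" "v $ i \<le> real (2 * M)" for i
      unfolding vi using b[of i] by linarith+
    then have "\<bar>F v - quad q p A v\<bar> \<le> E" by (rule cube)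
    moreover have "f y = h\<^sup>2 * F v"
      unfolding F_def v_def using h(1) by simp
    moreover have "quad (h\<^sup>2 * q) (h *\<^sub>R p) A (y - x0) = h\<^sup>2 * quad q p A v"
      unfolding v_def using h(1) by (simp add: quad_scale)
    ultimately have "\<bar>f y - quad (h\<^sup>2 * q) (h *\<^sub>R p) A (y - x0)\<bar> \<le> h\<^sup>2 * E"
      by (simp add: abs_mult mult_left_mono flip: right_diff_distrib)
    also have "\<dots> \<le> h\<^sup>2 * (\<eta> * (real M)\<^sup>2)" using M(2) by (intro mult_left_mono) auto
    finally show ?thesis by (simp add: power_mult_distrib mult_ac)
  qed
  moreover have "0 < h * M" using h(1) M(1) by simp
  ultimately show thesis using that[OF x _ h(2) A(1)] by blast
qed

section \<open>Contact points and insertion of a smooth function\<close>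

text \<open>At a contact point a plane lies above \<open>w\<close>, while semiconvexity limits how
  fast \<open>w\<close> can bend downwards. This is the usual C^{1,1} estimate on a contact set,
  obtained from the midpoint inequality alone.\<close>

lemma contact_slopes_Lipschitz:
  fixes w :: "'a::real_inner \<Rightarrow> real"
  assumes w: "semiconvex c w" and c: "c > 0"
    and x: "\<And>z. w z \<le> w x + p \<bullet> (z - x)" and y: "\<And>z. w z \<le> w y + q \<bullet> (z - y)"
  shows "norm (p - q) \<le> 4 * c * norm (x - y)"
proof -
  define d where "d = p - q"
  \<comment> \<open>The point x + h lies beyond \<open>y\<close> in the direction p - q and is
    estimated by the plane at \<open>y\<close>, its mirror image x - h by the plane at
    \<open>x\<close>. This \<open>t\<close> turns the outcome into a comparison of two
    squares.\<close>
  define t where "t = 1 / (4 * c)"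
  define h where "h = (y - x) + t *\<^sub>R d"
  have "2 * w x \<le> w (x + h) + w (x - h) + c * (norm h)\<^sup>2"
    by (rule semiconvex_midpoint[OF w])
  moreover have "w (x - h) \<le> w x - p \<bullet> h" using x[of "x - h"] by simp
  moreover have "w (x + h) \<le> w y + q \<bullet> (x + h - y)" by (rule y)
  moreover have "w y \<le> w x + p \<bullet> (y - x)" by (rule x)
  ultimately have "p \<bullet> h - p \<bullet> (y - x) - q \<bullet> (x + h - y) \<le> c * (norm h)\<^sup>2" by linarith
  moreover have "p \<bullet> h - p \<bullet> (y - x) - q \<bullet> (x + h - y) = t * (norm d)\<^sup>2"
    unfolding h_def d_def power2_norm_eq_inner by (simp add: inner_simps algebra_simps)
  moreover have "norm h \<le> norm (x - y) + t * norm d"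
    using norm_triangle_ineq[of "y - x" "t *\<^sub>R d"] c unfolding h_def by (simp add: t_def norm_minus_commute)
  then have "c * (norm h)\<^sup>2 \<le> c * (norm (x - y) + t * norm d)\<^sup>2"
    using c by (intro mult_left_mono power_mono) auto
  ultimately have "t * (norm d)\<^sup>2 \<le> c * (norm (x - y) + t * norm d)\<^sup>2" by linarith
  then have "4 * c * (t * (norm d)\<^sup>2) \<le> 4 * c * (c * (norm (x - y) + t * norm d)\<^sup>2)"
    using c by (intro mult_left_mono) auto
  also have "4 * c * (t * (norm d)\<^sup>2) = (norm d)\<^sup>2" using c by (simp add: t_def)
  also have "4 * c * (c * (norm (x - y) + t * norm d)\<^sup>2) = (2 * c * norm (x - y) + norm d / 2)\<^sup>2"
    using c by (simp add: t_def power2_eq_square field_simps)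
  finally have "norm d \<le> 2 * c * norm (x - y) + norm d / 2"
    by (rule power2_le_imp_le) (use c in auto)
  then show ?thesis unfolding d_def by simp
qed

text \<open>The area argument of Jensen's lemma without differentiation: the slope is Lipschitz on
  the contact set, its values fill a ball, and Lipschitz maps send null sets to null sets.\<close>

lemma contact_set_not_negligible:
  fixes w :: "'a::euclidean_space \<Rightarrow> real"
  assumes w: "semiconvex c w" and c: "c > 0" and "\<delta> > 0"
    and ex: "\<And>p. norm p \<le> \<delta> \<Longrightarrow> \<exists>x. \<forall>z. w z \<le> w x + p \<bullet> (z - x)"
  shows "\<not> negligible {x. \<exists>p. norm p \<le> \<delta> \<and> (\<forall>z. w z \<le> w x + p \<bullet> (z - x))}" (is "\<not> negligible ?K")
proof
  assume neg: "negligible ?K"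
  define g where "g x = (SOME p. norm p \<le> \<delta> \<and> (\<forall>z. w z \<le> w x + p \<bullet> (z - x)))" for x
  have g: "norm (g x) \<le> \<delta> \<and> (\<forall>z. w z \<le> w x + g x \<bullet> (z - x))" if "x \<in> ?K" for x
    unfolding g_def using that by (intro someI_ex[of "\<lambda>p. norm p \<le> \<delta> \<and> (\<forall>z. w z \<le> w x + p \<bullet> (z - x))"]) simp
  have "negligible (g ` ?K)"
  proof (rule negligible_locally_Lipschitz_image[OF _ neg])
    fix x assume x: "x \<in> ?K"
    have "norm (g y - g x) \<le> 4 * c * norm (y - x)" if "y \<in> ?K" for y
      using contact_slopes_Lipschitz[OF w c, of y "g y" x "g x"] g[OF x] g[OF that] by blast
    then show "\<exists>T B. open T \<and> x \<in> T \<and> (\<forall>y\<in>?K \<inter> T. norm (g y - g x) \<le> B * norm (y - x))"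
      by (intro exI[of _ UNIV] exI[of _ "4 * c"]) auto
  qed simp
  moreover have "ball 0 \<delta> \<subseteq> g ` ?K"
  proof
    fix p :: 'a assume "p \<in> ball 0 \<delta>"
    then have p: "norm p \<le> \<delta>" by simp
    then obtain x where x: "\<forall>z. w z \<le> w x + p \<bullet> (z - x)" using ex by blast
    then have K: "x \<in> ?K" using p by blast
    \<comment> \<open>With both points equal, the Lipschitz estimate says that the slope at a
      contact point is unique, so the chosen \<open>g x\<close> is \<open>p\<close>.\<close>
    then have "norm (p - g x) \<le> 4 * c * norm (x - x)"
      using contact_slopes_Lipschitz[OF w c, of x p x "g x"] g[OF K] x by blast
    then show "p \<in> g ` ?K" using K by (intro image_eqI[of _ _ x]) auto
  qed
  ultimately have "negligible (ball (0::'a) \<delta>)" using negligible_subset by blast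
  then show False using open_not_negligible[of "ball (0::'a) \<delta>"] \<open>\<delta> > 0\<close> by simp
qed

text \<open>Ilmanen's insertion: the largest semiconvex minorant of a semiconcave function is itself
  semiconcave, since convex combinations of its translates compete in the supremum.\<close>

lemma semiconvex_insertion:
  fixes U q :: "'a::real_inner \<Rightarrow> real"
  assumes U: "semiconvex c U" and q: "semiconvex c (\<lambda>x. - q x)" and Uq: "\<And>x. U x \<le> q x"
  obtains \<psi> where "semiconvex c \<psi>" "semiconvex c (\<lambda>x. - \<psi> x)" "\<And>x. U x \<le> \<psi> x" "\<And>x. \<psi> x \<le> q x"
proof -
  define G where "G = {g. semiconvex c g \<and> (\<forall>y. g y \<le> q y)}"
  define \<psi> where "\<psi> x = (SUP g\<in>G. g x)" for x
  have UG: "U \<in> G" unfolding G_def using U Uq by auto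
  have le: "g x \<le> \<psi> x" if "g \<in> G" for g x
    unfolding \<psi>_def using that by (intro cSUP_upper bdd_aboveI[of _ "q x"]) (auto simp: G_def)
  have \<psi>q: "\<psi> x \<le> q x" for x
    unfolding \<psi>_def using UG by (intro cSUP_least) (auto simp: G_def)
  have sc: "semiconvex c \<psi>"
    unfolding semiconvex_def
  proof (intro allI impI)
    fix x y :: 'a and t :: real assume t: "0 \<le> t" "t \<le> 1"
    show "\<psi> ((1 - t) *\<^sub>R x + t *\<^sub>R y) \<le> (1 - t) * \<psi> x + t * \<psi> y + c / 2 * (t * (1 - t)) * (norm (x - y))\<^sup>2"
      unfolding \<psi>_def[of "(1 - t) *\<^sub>R x + t *\<^sub>R y"]
    proof (rule cSUP_least)
      show "G \<noteq> {}" using UG by blast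
      fix g assume g: "g \<in> G"
      then have "g ((1 - t) *\<^sub>R x + t *\<^sub>R y) \<le> (1 - t) * g x + t * g y + c / 2 * (t * (1 - t)) * (norm (x - y))\<^sup>2"
        using t by (intro semiconvexD) (auto simp: G_def)
      moreover have "(1 - t) * g x \<le> (1 - t) * \<psi> x" "t * g y \<le> t * \<psi> y"
        using t le[OF g] by (auto intro!: mult_left_mono)
      ultimately show "g ((1 - t) *\<^sub>R x + t *\<^sub>R y) \<le> (1 - t) * \<psi> x + t * \<psi> y + c / 2 * (t * (1 - t)) * (norm (x - y))\<^sup>2"
        by linarith
    qed
  qed
  have "semiconvex c (\<lambda>x. - \<psi> x)"
    unfolding semiconvex_def
  proof (intro allI impI)
    fix x y :: 'a and t :: real assume t: "0 \<le> t" "t \<le> 1"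
    define k where "k = c / 2 * (t * (1 - t)) * (norm (x - y))\<^sup>2"
    \<comment> \<open>The shifts satisfy (1-t) a + t b = 0 and a - b = x - y. Hence the averaged
      translates, lowered by the semiconcavity defect \<open>k\<close> of \<open>q\<close>, stay in
      \<open>G\<close>; at the convex combination they evaluate \<psi> at \<open>x\<close> and
      \<open>y\<close>.\<close>
    define a where "a = t *\<^sub>R (x - y)"
    define b where "b = - ((1 - t) *\<^sub>R (x - y))"
    define g where "g z = (1 - t) * \<psi> (z + a) + t * \<psi> (z + b) - k" for z
    have "g \<in> G"
      unfolding G_def
    proof (intro CollectI conjI allI)
      show "semiconvex c g"
        unfolding semiconvex_def
      proof (intro allI impI)
        fix x y :: 'a and s :: real assume s: "0 \<le> s" "s \<le> 1"
        have e: "(1 - s) *\<^sub>R (x + v) + s *\<^sub>R (y + v) = (1 - s) *\<^sub>R x + s *\<^sub>R y + v" for v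
          by (simp add: algebra_simps)
        let ?R = "c / 2 * (s * (1 - s)) * (norm (x - y))\<^sup>2"
        have "\<psi> ((1 - s) *\<^sub>R x + s *\<^sub>R y + v) \<le> (1 - s) * \<psi> (x + v) + s * \<psi> (y + v) + ?R" for v
          using semiconvexD[OF sc s, of "x + v" "y + v"] unfolding e by simp
        then have "(1 - t) * \<psi> ((1 - s) *\<^sub>R x + s *\<^sub>R y + a) + t * \<psi> ((1 - s) *\<^sub>R x + s *\<^sub>R y + b)
          \<le> (1 - t) * ((1 - s) * \<psi> (x + a) + s * \<psi> (y + a) + ?R) + t * ((1 - s) * \<psi> (x + b) + s * \<psi> (y + b) + ?R)"
          using t by (intro add_mono mult_left_mono) auto
        also have "\<dots> = (1 - s) * (g x + k) + s * (g y + k) + ?R"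
        proof -
          have "(1 - t) * ((1 - s) * A + s * B + R) + t * ((1 - s) * C + s * D + R)
            = (1 - s) * ((1 - t) * A + t * C - k + k) + s * ((1 - t) * B + t * D - k + k) + R" for A B C D R :: real
            by (simp add: algebra_simps)
          then show ?thesis unfolding g_def .
        qed
        finally show "g ((1 - s) *\<^sub>R x + s *\<^sub>R y) \<le> (1 - s) * g x + s * g y + ?R"
          unfolding g_def[of "(1 - s) *\<^sub>R x + s *\<^sub>R y"] by (simp add: algebra_simps)
      qed
      fix z
      have "(1 - t) * \<psi> (z + a) + t * \<psi> (z + b) \<le> (1 - t) * q (z + a) + t * q (z + b)"
        using t by (intro add_mono mult_left_mono \<psi>q) auto
      moreover have "(1 - t) *\<^sub>R (z + a) + t *\<^sub>R (z + b) = z"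
        unfolding a_def b_def by (simp add: algebra_simps)
      moreover have "(z + a) - (z + b) = x - y"
        unfolding a_def b_def by (simp add: algebra_simps)
      ultimately show "g z \<le> q z"
        using semiconvexD[OF q t, of "z + a" "z + b"] unfolding g_def k_def by simp
    qed
    then have "g ((1 - t) *\<^sub>R x + t *\<^sub>R y) \<le> \<psi> ((1 - t) *\<^sub>R x + t *\<^sub>R y)" by (rule le)
    moreover have "(1 - t) *\<^sub>R x + t *\<^sub>R y + a = x" "(1 - t) *\<^sub>R x + t *\<^sub>R y + b = y"
      unfolding a_def b_def by (simp_all add: algebra_simps)
    ultimately show "- \<psi> ((1 - t) *\<^sub>R x + t *\<^sub>R y) \<le> (1 - t) * - \<psi> x + t * - \<psi> y + c / 2 * (t * (1 - t)) * (norm (x - y))\<^sup>2"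
      unfolding g_def k_def by simp
  qed
  with that sc le[OF UG] \<psi>q show thesis by blast
qed

section \<open>Touching by quadratic polynomials\<close>

text \<open>The second derivative is constant, so \<phi> is a quadratic polynomial with Hessian
  \<open>A\<close>. The gradient stays existential because \<Theta> sees only values and
  Hessians.\<close>

definition test_above :: "(real^'n \<Rightarrow> real) \<Rightarrow> real^'n^'n \<Rightarrow> real^'n \<Rightarrow> bool" where
  "test_above f A x \<longleftrightarrow> (\<exists>\<phi> g e. e > 0 \<and>
     (\<forall>y. (\<phi> has_derivative (\<lambda>h. g y \<bullet> h)) (at y) \<and> (g has_derivative (\<lambda>h. A *v h)) (at y)) \<and>
     f x = \<phi> x \<and> (\<forall>y\<in>ball x e. f y \<le> \<phi> y))"

text \<open>The polynomial is bent upwards by 4 \<eta> |y - x|^2. On the sphere of radius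
  \<open>r\<close> this outweighs both errors \<eta> r^2, so the maximum of f - Q is attained
  inside, where a lifted \<open>Q\<close> touches \<open>f\<close>; the bending costs 8 \<eta> in
  the Hessian.\<close>

lemma near_quadratic_imp_test_above:
  fixes f :: "real^'n \<Rightarrow> real"
  assumes f: "continuous_on UNIV f" and "\<eta> > 0" "r > 0" and A: "transpose A = A"
    and ub: "\<And>y. y \<in> cball x r \<Longrightarrow> f y \<le> quad k p A (y - x0) + \<eta> * r\<^sup>2"
    and lb: "quad k p A (x - x0) - \<eta> * r\<^sup>2 \<le> f x"
  obtains x1 where "x1 \<in> ball x r" "test_above f (A + (8 * \<eta>) *\<^sub>R mat 1) x1"
proof -
  define Q where "Q y = quad k p A (y - x0) + 4 * \<eta> * (norm (y - x))\<^sup>2" for y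
  define g where "g y = p + A *v (y - x0) + (8 * \<eta>) *\<^sub>R (y - x)" for y
  have bl: "bounded_linear ((*v) A)" by (rule matrix_vector_mul_bounded_linear)
  have Q: "(Q has_derivative (\<lambda>h. g y \<bullet> h)) (at y)" for y
    unfolding Q_def quad_def g_def power2_norm_eq_inner
    using symmetric_inner_commute[OF A]
    by (auto intro!: derivative_eq_intros bounded_linear.has_derivative[OF bl]
        simp: fun_eq_iff inner_simps inner_commute algebra_simps diff_divide_distrib)
  have g: "(g has_derivative (\<lambda>h. (A + (8 * \<eta>) *\<^sub>R mat 1) *v h)) (at y)" for y
    unfolding g_def
    by (auto intro!: derivative_eq_intros bounded_linear.has_derivative[OF bl]
        simp: fun_eq_iff matrix_vector_mult_add_rdistrib scaleR_matrix_vector_assoc[symmetric])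
  have "continuous_on (cball x r) (\<lambda>y. f y - Q y)"
    using Q by (intro continuous_intros continuous_on_subset[OF f] has_derivative_continuous_on[of _ Q]) (auto intro: has_derivative_at_withinI)
  then obtain x1 where x1: "x1 \<in> cball x r" "\<And>y. y \<in> cball x r \<Longrightarrow> f y - Q y \<le> f x1 - Q x1"
    using continuous_attains_sup[of "cball x r" "\<lambda>y. f y - Q y"] \<open>r > 0\<close> by auto
  have "x1 \<in> ball x r"
  proof (rule ccontr)
    assume "x1 \<notin> ball x r"
    then have "norm (x1 - x) = r" using x1(1) by (auto simp: dist_norm norm_minus_commute)
    then have "f x1 - Q x1 \<le> - 3 * (\<eta> * r\<^sup>2)" unfolding Q_def using ub[OF x1(1)] by simp
    moreover have "- (\<eta> * r\<^sup>2) \<le> f x - Q x" unfolding Q_def using lb by simp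
    moreover have "f x - Q x \<le> f x1 - Q x1" using x1(2) \<open>r > 0\<close> by simp
    moreover have "\<eta> * r\<^sup>2 > 0" using \<open>\<eta> > 0\<close> \<open>r > 0\<close> by simp
    ultimately show False by linarith
  qed
  moreover from this obtain e where e: "e > 0" "ball x1 e \<subseteq> ball x r"
    using open_ball[of x r] unfolding open_contains_ball by blast
  have "test_above f (A + (8 * \<eta>) *\<^sub>R mat 1) x1"
    unfolding test_above_def
  proof (intro exI[of _ "\<lambda>y. Q y + (f x1 - Q x1)"] exI[of _ g] exI[of _ e] conjI allI ballI)
    show "((\<lambda>y. Q y + (f x1 - Q x1)) has_derivative (\<lambda>h. g y \<bullet> h)) (at y)" for y
      using Q by (auto intro!: derivative_eq_intros)
    show "f y \<le> Q y + (f x1 - Q x1)" if "y \<in> ball x1 e" for y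
      using x1(2)[of y] e that by force
  qed (use e g in auto)
  ultimately show thesis using that by blast
qed


text \<open>This plays the role of the theorem on sums: the Hessians are opposite up to \<eta>. The
  price is a pair of nearby contact points instead of a common one, which Hausdorff continuity of
  \<Theta> can absorb.\<close>

lemma simultaneous_test_points:
  fixes U W :: "real^'n \<Rightarrow> real"
  assumes U: "semiconvex c U" and W: "semiconvex c W" and "c > 0"
    and growth: "\<And>x. U x + W x \<le> D - k * (norm x)\<^sup>2" and "k > 0" "\<eta> > 0" "\<tau> > 0"
  obtains x1 x2 A where "dist x1 x2 < \<tau>" "U x0 + W x0 - \<tau> < U x1 + W x2" "transpose A = A"
    "test_above U (A + \<eta> *\<^sub>R mat 1) x1" "test_above W (- A + \<eta> *\<^sub>R mat 1) x2"
proof -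
  define w where "w x = U x + W x" for x
  have contU: "continuous_on UNIV U" and contW: "continuous_on UNIV W"
    using U W semiconvex_continuous by blast+
  have contw: "continuous_on UNIV w" unfolding w_def by (intro continuous_intros contU contW)
  have scw: "semiconvex (2 * c) w" using semiconvex_add[OF U W] unfolding w_def by simp
  \<comment> \<open>Outside this ball the quadratic decay of \<open>w\<close> beats every linear
    function of slope at most 1, so all contact points lie inside.\<close>
  define R where "R = max 1 ((\<bar>D - w 0\<bar> + 1) / k)"
  have out: "w y + norm y < w 0" if "norm y > R" for y
  proof -
    have "(\<bar>D - w 0\<bar> + 1) / k < norm y" "1 < norm y" using that by (auto simp: R_def)
    then have "(\<bar>D - w 0\<bar> + 1) * norm y < k * norm y * norm y"
      using \<open>k > 0\<close> by (intro mult_strict_right_mono) (auto simp: field_simps)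
    moreover have "\<bar>D - w 0\<bar> * 1 \<le> \<bar>D - w 0\<bar> * norm y" using \<open>1 < norm y\<close> by (intro mult_left_mono) auto
    ultimately have "\<bar>D - w 0\<bar> + norm y < k * (norm y)\<^sup>2" by (simp add: power2_eq_square algebra_simps)
    then show ?thesis using growth[of y] unfolding w_def by linarith
  qed
  have R: "R \<ge> 1" by (simp add: R_def)
  define S where "S = norm x0 + R"
  have S: "S > 0" using R norm_ge_zero[of x0] unfolding S_def by linarith
  \<comment> \<open>Contact points are at distance at most \<open>S\<close> from \<open>x0\<close>,
    so slopes this small cost at most \<tau>/4 against the value at \<open>x0\<close>.\<close>
  define \<delta> where "\<delta> = min 1 (\<tau> / (4 * S))"
  have \<delta>: "\<delta> > 0" "\<delta> \<le> 1" "\<delta> * S \<le> \<tau> / 4"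
  proof -
    show "\<delta> > 0" "\<delta> \<le> 1" using \<open>\<tau> > 0\<close> S by (auto simp: \<delta>_def)
    have "\<delta> * S \<le> \<tau> / (4 * S) * S"
      using S by (intro mult_right_mono) (auto simp: \<delta>_def)
    then show "\<delta> * S \<le> \<tau> / 4" using S by simp
  qed
  have ip: "- norm y \<le> p \<bullet> y" "p \<bullet> y \<le> norm y" if "norm p \<le> \<delta>" for p y :: "real^'n"
  proof -
    have "\<bar>p \<bullet> y\<bar> \<le> norm p * norm y" by (rule Cauchy_Schwarz_ineq2)
    also have "\<dots> \<le> 1 * norm y" using that \<delta>(2) by (intro mult_right_mono) auto
    finally show "- norm y \<le> p \<bullet> y" "p \<bullet> y \<le> norm y" by auto
  qed
  have ex: "\<exists>x. \<forall>z. w z \<le> w x + p \<bullet> (z - x)" if p: "norm p \<le> \<delta>" for p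
  proof -
    have "\<exists>x\<in>cball 0 R. \<forall>y\<in>cball 0 R. w y - p \<bullet> y \<le> w x - p \<bullet> x"
      using R by (intro continuous_attains_sup continuous_intros continuous_on_subset[OF contw]) auto
    then obtain x where "\<forall>y\<in>cball 0 R. w y - p \<bullet> y \<le> w x - p \<bullet> x" by blast
    then have x: "w y - p \<bullet> y \<le> w x - p \<bullet> x" if "norm y \<le> R" for y using that by simp
    have "w y - p \<bullet> y \<le> w x - p \<bullet> x" for y
    proof (cases "norm y \<le> R")
      case False
      then have "w y - p \<bullet> y \<le> w 0" using out[of y] ip[OF p, of y] by simp
      then show ?thesis using x[of 0] R by simp
    qed (use x in auto)
    then show ?thesis by (intro exI[of _ x]) (simp add: inner_diff_right algebra_simps)
  qed
  define K where "K = {x. \<exists>p. norm p \<le> \<delta> \<and> (\<forall>z. w z \<le> w x + p \<bullet> (z - x))}"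
  have K_neg: "\<not> negligible K"
    unfolding K_def using contact_set_not_negligible[OF scw _ \<delta>(1) ex] \<open>c > 0\<close> by simp
  have KR: "norm x \<le> R" if K: "x \<in> K" for x
  proof (rule ccontr)
    assume "\<not> norm x \<le> R"
    obtain p where p: "norm p \<le> \<delta>" "\<forall>z. w z \<le> w x + p \<bullet> (z - x)" using K by (auto simp: K_def)
    have "w 0 \<le> w x - p \<bullet> x" using p(2)[rule_format, of 0] by simp
    then show False using out[of x] ip[OF p(1), of x] \<open>\<not> norm x \<le> R\<close> by simp
  qed
  obtain X where X: "\<And>p z. norm p \<le> \<delta> \<Longrightarrow> w z \<le> w (X p) + p \<bullet> (z - X p)" using ex by metis
  \<comment> \<open>One contact plane is chosen per slope. As an infimum of affine functions
    \<Gamma> is concave, so \<Gamma> - W is semiconcave with the constant of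
    \<open>W\<close>.\<close>
  define \<Gamma> where "\<Gamma> y = (INF p\<in>cball 0 \<delta>. w (X p) + p \<bullet> (y - X p))" for y
  have ne: "cball (0::real^'n) \<delta> \<noteq> {}" using \<delta> by simp
  have \<Gamma>_le: "\<Gamma> y \<le> w (X p) + p \<bullet> (y - X p)" if "norm p \<le> \<delta>" for p y
    unfolding \<Gamma>_def using that X by (intro cINF_lower bdd_belowI[of _ "w y"]) auto
  have w\<Gamma>: "w y \<le> \<Gamma> y" for y
    unfolding \<Gamma>_def using ne X by (intro cINF_greatest) auto
  have "semiconvex 0 (\<lambda>y. - \<Gamma> y)"
    unfolding semiconvex_def
  proof (intro allI impI)
    fix x y :: "real^'n" and t :: real assume t: "0 \<le> t" "t \<le> 1"
    have "(1 - t) * \<Gamma> x + t * \<Gamma> y \<le> \<Gamma> ((1 - t) *\<^sub>R x + t *\<^sub>R y)"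
      unfolding \<Gamma>_def[of "(1 - t) *\<^sub>R x + t *\<^sub>R y"]
    proof (rule cINF_greatest[OF ne])
      fix p :: "real^'n" assume "p \<in> cball 0 \<delta>"
      then have "(1 - t) * \<Gamma> x + t * \<Gamma> y \<le> (1 - t) * (w (X p) + p \<bullet> (x - X p)) + t * (w (X p) + p \<bullet> (y - X p))"
        using t by (intro add_mono mult_left_mono \<Gamma>_le) auto
      also have "\<dots> = w (X p) + p \<bullet> ((1 - t) *\<^sub>R x + t *\<^sub>R y - X p)"
        by (simp add: inner_simps algebra_simps)
      finally show "(1 - t) * \<Gamma> x + t * \<Gamma> y \<le> \<dots>" .
    qed
    then show "- \<Gamma> ((1 - t) *\<^sub>R x + t *\<^sub>R y) \<le> (1 - t) * - \<Gamma> x + t * - \<Gamma> y + 0 / 2 * (t * (1 - t)) * (norm (x - y))\<^sup>2"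
      by simp
  qed
  from semiconvex_add[OF W this] have q1: "semiconvex c (\<lambda>y. - (\<Gamma> y - W y))" by simp
  have q2: "U y \<le> \<Gamma> y - W y" for y using w\<Gamma>[of y] by (simp add: w_def)
  obtain \<psi> where \<psi>: "semiconvex c \<psi>" "semiconvex c (\<lambda>x. - \<psi> x)"
      and U\<psi>: "\<And>x. U x \<le> \<psi> x" and \<psi>\<Gamma>: "\<And>x. \<psi> x \<le> \<Gamma> x - W x"
    by (rule semiconvex_insertion[OF U q1 q2]) (rule that)
  have unif: "\<exists>d>0. \<forall>x y. norm x \<le> R \<longrightarrow> dist x y < d \<longrightarrow> \<bar>f x - f y\<bar> < \<tau> / 4" if "continuous_on UNIV f"
    for f :: "real^'n \<Rightarrow> real"
  proof -
    have "uniformly_continuous_on (cball 0 (R + 1)) f"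
      using that by (intro compact_uniformly_continuous) (auto intro: continuous_on_subset)
    then obtain d where d: "d > 0"
      "\<And>x y. x \<in> cball 0 (R + 1) \<Longrightarrow> y \<in> cball 0 (R + 1) \<Longrightarrow> dist y x < d \<Longrightarrow> dist (f y) (f x) < \<tau> / 4"
      using \<open>\<tau> > 0\<close> unfolding uniformly_continuous_on_def by (metis divide_pos_pos zero_less_numeral)
    show ?thesis
    proof (intro exI[of _ "min d 1"] conjI allI impI)
      fix x y :: "real^'n" assume x: "norm x \<le> R" and "dist x y < min d 1"
      moreover from this have "norm y \<le> R + 1"
        using norm_triangle_ineq4[of x "x - y"] by (simp add: dist_norm)
      ultimately show "\<bar>f x - f y\<bar> < \<tau> / 4" using d(2)[of y x] by (simp add: dist_real_def)
    qed (use d in auto)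
  qed
  obtain dU dW where dU: "dU > 0" "\<And>x y. norm x \<le> R \<Longrightarrow> dist x y < dU \<Longrightarrow> \<bar>U x - U y\<bar> < \<tau> / 4"
    and dW: "dW > 0" "\<And>x y. norm x \<le> R \<Longrightarrow> dist x y < dW \<Longrightarrow> \<bar>W x - W y\<bar> < \<tau> / 4"
    using unif[OF contU] unif[OF contW] by blast
  define r0 where "r0 = Min {dU, dW, \<tau> / 2}"
  have r0: "r0 > 0" "r0 \<le> dU" "r0 \<le> dW" "r0 \<le> \<tau> / 2" using dU dW \<open>\<tau> > 0\<close> by (auto simp: r0_def)
  have K_bd: "bounded K" using KR by (auto simp: bounded_iff)
  \<comment> \<open>The later bending adds eight times this tolerance to the Hessian.\<close>
  have \<eta>8: "\<eta> / 8 > 0" using \<open>\<eta> > 0\<close> by simp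
  obtain x r b m p A where x: "x \<in> K" and r: "0 < r" "r \<le> r0" and A: "transpose A = A"
    and approx: "\<And>y. y \<in> cball x r \<Longrightarrow> \<bar>\<psi> y - quad m p A (y - b)\<bar> \<le> \<eta> / 8 * r\<^sup>2"
  proof (rule quadratic_approximation_point[OF \<psi> K_bd K_neg \<eta>8 r0(1)])
    fix x r b m p A
    assume "x \<in> K" "0 < r" "r \<le> r0" "transpose A = A"
      "\<And>y. y \<in> cball x r \<Longrightarrow> \<bar>\<psi> y - quad m p A (y - b)\<bar> \<le> \<eta> / 8 * r\<^sup>2"
    then show thesis by (rule that)
  qed
  obtain q where q: "norm q \<le> \<delta>" "\<And>z. w z \<le> w x + q \<bullet> (z - x)" using x by (auto simp: K_def)
  \<comment> \<open>The chosen \<open>X q\<close> may differ from \<open>x\<close>, but its plane is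
    no higher than the one through \<open>x\<close>, since the latter bounds \<open>w\<close> at
    \<open>X q\<close>.\<close>
  have \<Gamma>x: "\<Gamma> y \<le> w x + q \<bullet> (y - x)" for y
    using \<Gamma>_le[OF q(1), of y] q(2)[of "X q"] by (simp add: inner_diff_right)
  have \<psi>x: "\<psi> x = U x" using U\<psi>[of x] \<psi>\<Gamma>[of x] \<Gamma>x[of x] by (simp add: w_def)
  have xr: "x \<in> cball x r" using r by simp
  obtain x1 where x1: "x1 \<in> ball x r" "test_above U (A + (8 * (\<eta> / 8)) *\<^sub>R mat 1) x1"
  proof (rule near_quadratic_imp_test_above[OF contU _ r(1) A])
    show "U y \<le> quad m p A (y - b) + \<eta> / 8 * r\<^sup>2" if "y \<in> cball x r" for y
      using approx[OF that] U\<psi>[of y] by linarith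
    show "quad m p A (x - b) - \<eta> / 8 * r\<^sup>2 \<le> U x"
      using approx[OF xr] \<psi>x by linarith
  qed (use \<open>\<eta> > 0\<close> in auto)
  \<comment> \<open>\<open>W\<close> lies below \<Gamma> - \<psi>, hence below the plane at
    \<open>x\<close> minus \<psi>. This is the constant term of the resulting polynomial with
    Hessian \<open>- A\<close>.\<close>
  define m' where "m' = w x + q \<bullet> (b - x) - m"
  have quad': "quad m' (q - p) (- A) (y - b) = w x + q \<bullet> (y - x) - quad m p A (y - b)" for y
    by (simp add: quad_def m'_def uminus_matrix_vector inner_simps diff_divide_distrib)
  have A': "transpose (- A) = - A" using A by (simp add: transpose_def vec_eq_iff)
  obtain x2 where x2: "x2 \<in> ball x r" "test_above W (- A + (8 * (\<eta> / 8)) *\<^sub>R mat 1) x2"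
  proof (rule near_quadratic_imp_test_above[OF contW _ r(1) A'])
    show "W y \<le> quad m' (q - p) (- A) (y - b) + \<eta> / 8 * r\<^sup>2" if "y \<in> cball x r" for y
      using approx[OF that] \<psi>\<Gamma>[of y] \<Gamma>x[of y] unfolding quad' by linarith
    show "quad m' (q - p) (- A) (x - b) - \<eta> / 8 * r\<^sup>2 \<le> W x"
      using approx[OF xr] \<psi>x unfolding quad' w_def diff_self inner_zero_right by linarith
  qed (use \<open>\<eta> > 0\<close> in auto)
  have "dist x x1 < r" "dist x x2 < r" using x1 x2 by auto
  then have "dist x1 x2 < \<tau>"
    using dist_triangle3[of x1 x2 x] r(2) r0(4) by linarith
  moreover have "U x0 + W x0 - \<tau> < U x1 + W x2"
  proof -
    have "\<bar>U x - U x1\<bar> < \<tau> / 4" "\<bar>W x - W x2\<bar> < \<tau> / 4"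
      using dU(2)[OF KR[OF x], of x1] dW(2)[OF KR[OF x], of x2] \<open>dist x x1 < r\<close> \<open>dist x x2 < r\<close> r(2) r0 by auto
    moreover have "w x0 \<le> w x + \<tau> / 4"
    proof -
      have "q \<bullet> (x0 - x) \<le> norm q * norm (x0 - x)" by (rule norm_cauchy_schwarz)
      also have "\<dots> \<le> \<delta> * S"
        unfolding S_def using q(1) \<delta>(1) KR[OF x] norm_triangle_ineq4[of x0 x] by (intro mult_mono) auto
      finally show ?thesis using q(2)[of x0] \<delta>(3) by linarith
    qed
    ultimately show ?thesis using \<open>\<tau> > 0\<close> unfolding w_def by linarith
  qed
  ultimately show thesis using that A x1(2) x2(2) by simp
qed

section \<open>Upper semicontinuity and sup-convolution\<close>

text \<open>If each \<open>x\<close> were beaten by some \<open>m x\<close>, neighbourhoods on which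
  \<open>f\<close> stays below \<open>f (m x)\<close> would have a finite subcover, and the best of
  these finitely many \<open>m x\<close> would be beaten by another.\<close>

lemma usc_attains_max:
  fixes f :: "'a::topological_space \<Rightarrow> ereal"
  assumes "compact S" "S \<noteq> {}" "usc_on S f"
  shows "\<exists>x\<in>S. \<forall>y\<in>S. f y \<le> f x"
proof (rule ccontr)
  assume "\<not> ?thesis"
  then obtain m where m: "\<And>x. x \<in> S \<Longrightarrow> m x \<in> S \<and> f x < f (m x)" by (metis not_le)
  have "\<exists>T. open T \<and> x \<in> T \<and> (\<forall>z\<in>T \<inter> S. f z < f (m x))" if x: "x \<in> S" for x
  proof -
    have "eventually (\<lambda>z. f z < f (m x)) (at x within S)"
      using assms(3) m[OF x] x unfolding usc_on_def by blast
    then obtain T where "open T" "x \<in> T" "\<forall>z\<in>T. z \<noteq> x \<longrightarrow> z \<in> S \<longrightarrow> f z < f (m x)"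
      unfolding eventually_at_topological by blast
    moreover have "f x < f (m x)" using m[OF x] by simp
    ultimately show ?thesis by (intro exI[of _ T]) auto
  qed
  then obtain T where T: "\<And>x. x \<in> S \<Longrightarrow> open (T x) \<and> x \<in> T x \<and> (\<forall>z\<in>T x \<inter> S. f z < f (m x))" by metis
  obtain C where C: "C \<subseteq> S" "finite C" "S \<subseteq> (\<Union>x\<in>C. T x)"
    by (rule compactE_image[OF \<open>compact S\<close>, of S T]) (use T in auto)
  then have "C \<noteq> {}" using \<open>S \<noteq> {}\<close> by auto
  let ?M = "Max ((\<lambda>x. f (m x)) ` C)"
  have "?M \<in> (\<lambda>x. f (m x)) ` C" using C \<open>C \<noteq> {}\<close> by (intro Max_in) auto
  then obtain x where x: "?M = f (m x)" "x \<in> C" by (rule imageE)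
  then have "m x \<in> S" using m C by blast
  then obtain y where y: "y \<in> C" "m x \<in> T y" using C by blast
  then have "f (m x) < f (m y)" using T C \<open>m x \<in> S\<close> by blast
  also have "\<dots> \<le> ?M" using y C by (intro Max_ge) auto
  finally show False using x by simp
qed

lemma usc_on_add_continuous:
  fixes f :: "'a::topological_space \<Rightarrow> ereal"
  assumes f: "usc_on S f" and h: "continuous_on UNIV h"
  shows "usc_on S (\<lambda>y. f y + ereal (h y))"
  unfolding usc_on_def
proof (intro ballI conjI allI impI)
  fix x assume x: "x \<in> S"
  show "f x + ereal (h x) \<noteq> \<infinity>" using f x by (auto simp: usc_on_def)
  fix c assume c: "f x + ereal (h x) < c"
  show "\<forall>\<^sub>F y in at x within S. f y + ereal (h y) < c"
  proof (cases c)
    case (real c')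
    have "f x < ereal (c' - h x)"
      using c unfolding real by (cases "f x") auto
    \<comment> \<open>The slack is split at a real \<open>t\<close>, which also works when
      \<open>f x\<close> is -\<infinity>.\<close>
    then obtain t where t: "f x < ereal t" "ereal t < ereal (c' - h x)"
      using ereal_dense2 by blast
    have "\<forall>\<^sub>F y in at x within S. f y < ereal t"
      using f x t(1) unfolding usc_on_def by blast
    moreover have "(h \<longlongrightarrow> h x) (at x within S)"
      using h by (meson UNIV_I continuous_on_def subset_UNIV tendsto_within_subset)
    then have "\<forall>\<^sub>F y in at x within S. h y < c' - t"
      using t(2) by (intro order_tendstoD(2)) auto
    ultimately show ?thesis
    proof eventually_elim
      case (elim y)
      then show ?case unfolding real by (cases "f y") auto
    qed
  next
    case PInf
    have "\<forall>\<^sub>F y in at x within S. y \<in> S" by (simp add: eventually_at_topological) blast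
    then show ?thesis
    proof eventually_elim
      case (elim y)
      then have "f y \<noteq> \<infinity>" using f by (auto simp: usc_on_def)
      then show ?case unfolding PInf by (cases "f y") auto
    qed
  qed (use c in auto)
qed

text \<open>\<open>U x\<close> is the supremum of f y - c/2 |x - y|^2 over \<open>S\<close>:
  attained by compactness, real because \<open>f\<close> is somewhere finite, and defined on the
  whole space.\<close>

lemma sup_convolution:
  fixes f :: "'a::real_inner \<Rightarrow> ereal"
  assumes S: "compact S" and f: "usc_on S f" and ex: "y0 \<in> S" "f y0 \<noteq> -\<infinity>"
  obtains U where "semiconvex c U" "\<And>x. \<exists>y\<in>S. f y = ereal (U x + c / 2 * (norm (x - y))\<^sup>2)"
    "\<And>x y. y \<in> S \<Longrightarrow> f y \<le> ereal (U x + c / 2 * (norm (x - y))\<^sup>2)"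
proof -
  have "\<exists>r. (\<exists>y\<in>S. f y = ereal (r + c / 2 * (norm (x - y))\<^sup>2)) \<and> (\<forall>y\<in>S. f y \<le> ereal (r + c / 2 * (norm (x - y))\<^sup>2))" for x
  proof -
    define g where "g y = f y + ereal (- (c / 2 * (norm (x - y))\<^sup>2))" for y
    have g: "usc_on S g" unfolding g_def by (intro usc_on_add_continuous[OF f] continuous_intros)
    then obtain y where y: "y \<in> S" "\<And>z. z \<in> S \<Longrightarrow> g z \<le> g y"
      using usc_attains_max[OF S _ g] ex by blast
    have "g y \<noteq> \<infinity>" using g y(1) by (auto simp: usc_on_def)
    moreover have "g y0 \<noteq> -\<infinity>" using ex(2) by (cases "f y0") (auto simp: g_def)
    then have "g y \<noteq> -\<infinity>" using y(2)[OF ex(1)] by auto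
    ultimately obtain r where r: "g y = ereal r" by (cases "g y") auto
    have eq: "f y = ereal (r + c / 2 * (norm (x - y))\<^sup>2)"
      using r unfolding g_def by (cases "f y") auto
    have "f z \<le> ereal (r + c / 2 * (norm (x - z))\<^sup>2)" if "z \<in> S" for z
      using y(2)[OF that] unfolding r g_def[of z] by (cases "f z") auto
    then show ?thesis using eq y(1) by blast
  qed
  then obtain U where U: "\<And>x. \<exists>y\<in>S. f y = ereal (U x + c / 2 * (norm (x - y))\<^sup>2)"
    "\<And>x y. y \<in> S \<Longrightarrow> f y \<le> ereal (U x + c / 2 * (norm (x - y))\<^sup>2)" by metis
  have "semiconvex c U"
    unfolding semiconvex_def
  proof (intro allI impI)
    fix x y :: 'a and t :: real assume t: "0 \<le> t" "t \<le> 1"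
    let ?z = "(1 - t) *\<^sub>R x + t *\<^sub>R y"
    \<comment> \<open>The maximiser at the convex combination competes at both \<open>x\<close> and
      \<open>y\<close>.\<close>
    obtain a where a: "a \<in> S" "f a = ereal (U ?z + c / 2 * (norm (?z - a))\<^sup>2)" using U(1) by blast
    define k where "k = U ?z + c / 2 * (norm (?z - a))\<^sup>2"
    have "k \<le> U x + c / 2 * (norm (x - a))\<^sup>2" "k \<le> U y + c / 2 * (norm (y - a))\<^sup>2"
      using U(2)[OF a(1), of x] U(2)[OF a(1), of y] unfolding a(2) k_def by simp_all
    then have "(1 - t) * k + t * k \<le> (1 - t) * (U x + c / 2 * (norm (x - a))\<^sup>2) + t * (U y + c / 2 * (norm (y - a))\<^sup>2)"
      using t by (intro add_mono mult_left_mono) simp_all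
    moreover have "(1 - t) * k + t * k = k" by (simp add: algebra_simps)
    moreover have "k = U ?z + c / 2 * ((1 - t) * (norm (x - a))\<^sup>2 + t * (norm (y - a))\<^sup>2 - t * (1 - t) * (norm (x - y))\<^sup>2)"
      unfolding k_def norm_sq_convex_combination ..
    ultimately show "U ?z \<le> (1 - t) * U x + t * U y + c / 2 * (t * (1 - t)) * (norm (x - y))\<^sup>2"
      by (simp add: algebra_simps add_divide_distrib diff_divide_distrib)
  qed
  with U that show thesis by blast
qed

section \<open>Spectral bounds for symmetric matrices\<close>

text \<open>Eigenvectors for distinct eigenvalues are orthogonal. Finiteness is what gives the
  \<open>Max\<close> in \<open>jet_norm\<close> its meaning.\<close>

lemma finite_eigenvalues:
  fixes A :: "real^'n^'n"
  assumes A: "transpose A = A"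
  shows "finite (eigenvalues A)"
proof -
  have "\<exists>v. v \<noteq> 0 \<and> A *v v = l *\<^sub>R v" if "l \<in> eigenvalues A" for l
    using that by (auto simp: eigenvalues_def)
  then obtain v where v: "\<And>l. l \<in> eigenvalues A \<Longrightarrow> v l \<noteq> 0 \<and> A *v v l = l *\<^sub>R v l" by metis
  have orth: "v k \<bullet> v l = 0" if "k \<in> eigenvalues A" "l \<in> eigenvalues A" "k \<noteq> l" for k l
  proof -
    have "k * (v k \<bullet> v l) = v l \<bullet> (A *v v k)" using v[OF that(1)] by (simp add: inner_commute)
    also have "\<dots> = v k \<bullet> (A *v v l)" by (rule symmetric_inner_commute[OF A])
    also have "\<dots> = l * (v k \<bullet> v l)" using v[OF that(2)] by simp
    finally show ?thesis using that(3) by simp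
  qed
  have "inj_on v (eigenvalues A)"
    using orth v by (metis inj_onI inner_eq_zero_iff)
  moreover have "finite (v ` eigenvalues A)"
    using orth by (intro pairwise_orthogonal_imp_finite) (auto simp: pairwise_def orthogonal_def)
  ultimately show ?thesis using finite_imageD by blast
qed

text \<open>Rayleigh's argument: a minimiser of the form on the unit sphere is an eigenvector, since
  a nonzero residual \<open>g\<close> would give a direction of descent.\<close>

lemma least_eigenvalue:
  fixes A :: "real^'n^'n"
  assumes A: "transpose A = A"
  obtains l where "l \<in> eigenvalues A" "\<And>x. l * (norm x)\<^sup>2 \<le> x \<bullet> (A *v x)"
proof -
  have "continuous_on (sphere 0 1) (\<lambda>x::real^'n. x \<bullet> (A *v x))"
    by (intro continuous_intros linear_continuous_on matrix_vector_mul_bounded_linear)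
  moreover have "sphere (0::real^'n) 1 \<noteq> {}" 
  proof -
    have "axis undefined 1 \<in> sphere (0::real^'n) 1" by (simp add: norm_axis_1)
    then show ?thesis by blast
  qed
  ultimately obtain v where v: "v \<in> sphere 0 1" "\<forall>x\<in>sphere 0 1. v \<bullet> (A *v v) \<le> x \<bullet> (A *v x)"
    using continuous_attains_inf[of "sphere 0 1" "\<lambda>x::real^'n. x \<bullet> (A *v x)"] by auto
  define l where "l = v \<bullet> (A *v v)"
  have min: "l * (norm x)\<^sup>2 \<le> x \<bullet> (A *v x)" for x
  proof (cases "x = 0")
    case False
    then have "l \<le> (x /\<^sub>R norm x) \<bullet> (A *v (x /\<^sub>R norm x))"
      unfolding l_def using v(2)[rule_format, of "x /\<^sub>R norm x"] by simp
    then show ?thesis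
      using False by (simp add: matrix_vector_mult_scaleR field_simps power2_eq_square)
  qed simp
  define g where "g = A *v v - l *\<^sub>R v"
  define q where "q x = x \<bullet> (A *v x) - l * (norm x)\<^sup>2" for x
  have nv: "norm v = 1" using v by simp
  \<comment> \<open>First variation of the nonnegative form \<open>q\<close> at its zero
    \<open>v\<close> in the direction -g; small \<open>s\<close> will force g = 0.\<close>
  have "2 * (norm g)\<^sup>2 \<le> s * q g" if "s > 0" for s
  proof -
    have "0 \<le> q (v - s *\<^sub>R g)" unfolding q_def using min by simp
    also have "q (v - s *\<^sub>R g) = q v - 2 * s * (g \<bullet> (A *v v) - l * (g \<bullet> v)) + s\<^sup>2 * q g"
      unfolding q_def power2_norm_eq_inner matrix_vector_mult_diff_distrib matrix_vector_mult_scaleR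
      using symmetric_inner_commute[OF A, of v g]
      by (simp add: inner_simps inner_commute[of v g] power2_eq_square algebra_simps)
    also have "q v = 0" unfolding q_def l_def nv by simp
    also have "g \<bullet> (A *v v) - l * (g \<bullet> v) = (norm g)\<^sup>2"
      unfolding power2_norm_eq_inner by (simp add: g_def inner_simps)
    finally have "s * (2 * (norm g)\<^sup>2) \<le> s * (s * q g)" by (simp add: power2_eq_square algebra_simps)
    then show ?thesis using that by simp
  qed
  note sq = this
  have "g = 0"
  proof (rule ccontr)
    assume "g \<noteq> 0"
    then have pos: "(norm g)\<^sup>2 > 0" by simp
    define s where "s = (norm g)\<^sup>2 / (\<bar>q g\<bar> + 1)"
    have "s > 0" using pos by (simp add: s_def)
    have "s * q g \<le> s * (\<bar>q g\<bar> + 1)" using \<open>s > 0\<close> by (intro mult_left_mono) auto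
    also have "\<dots> = (norm g)\<^sup>2" by (simp add: s_def)
    finally show False using sq[OF \<open>s > 0\<close>] pos by linarith
  qed
  then have "A *v v = l *\<^sub>R v" by (simp add: g_def)
  then have "l \<in> eigenvalues A" unfolding eigenvalues_def using nv by (intro CollectI exI[of _ v]) auto
  then show thesis using that min by blast
qed

text \<open>The least eigenvalue of A - B is at least -e. For the matrices this one-sided bound
  suffices, because elliptic maps respond to the order.\<close>

lemma jet_dist_less_imp:
  fixes A B :: "real^'n^'n"
  assumes "(r, A) \<in> JSpace" "(s, B) \<in> JSpace" and d: "jet_dist (r, A) (s, B) < e"
  shows "\<bar>r - s\<bar> < e" "x \<bullet> (B *v x) - e * (norm x)\<^sup>2 \<le> x \<bullet> (A *v x)"
proof -
  have sym: "transpose (A - B) = A - B"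
    using assms by (simp add: JSpace_def Sym_def symmetric_mat_def transpose_def vec_eq_iff)
  from d show "\<bar>r - s\<bar> < e" by (simp add: jet_dist_def jet_norm_def)
  obtain l where l: "l \<in> eigenvalues (A - B)" "\<And>x. l * (norm x)\<^sup>2 \<le> x \<bullet> ((A - B) *v x)"
    using least_eigenvalue[OF sym] by blast
  have "\<bar>l\<bar> \<le> Max (abs ` eigenvalues (A - B))"
    using l(1) finite_eigenvalues[OF sym] by (intro Max_ge) auto
  moreover have "Max (abs ` eigenvalues (A - B)) < e" using d by (simp add: jet_dist_def jet_norm_def)
  ultimately have "- e \<le> l" by linarith
  then have "- e * (norm x)\<^sup>2 \<le> l * (norm x)\<^sup>2" by (intro mult_right_mono) auto
  with l(2)[of x] show "x \<bullet> (B *v x) - e * (norm x)\<^sup>2 \<le> x \<bullet> (A *v x)"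
    by (simp add: matrix_vector_mult_diff_rdistrib inner_simps)
qed

section \<open>Elliptic maps and test jets\<close>

lemma proper_elliptic_map_mono:
  fixes A A' :: "real^'n^'n"
  assumes "proper_elliptic_map \<Omega> \<Theta>" "x \<in> \<Omega>" and A: "(r, A) \<in> \<Theta> x"
    and "r' \<le> r" "transpose A' = A'" "\<And>w. w \<bullet> (A *v w) \<le> w \<bullet> (A' *v w)"
  shows "(r', A') \<in> \<Theta> x"
proof -
  have \<Theta>: "\<Theta> x \<subseteq> JSpace" "{(r + s, A + P) | r A s P. (r, A) \<in> \<Theta> x \<and> (s, P) \<in> Qcone} \<subseteq> \<Theta> x"
    using assms(1,2) unfolding proper_elliptic_map_def by blast+
  then have "transpose A = A" using A by (auto simp: JSpace_def Sym_def symmetric_mat_def)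
  then have "transpose (A' - A) = A' - A"
    using assms(5) by (simp add: transpose_def vec_eq_iff)
  then have "(r' - r, A' - A) \<in> Qcone"
    using assms(4,6) by (simp add: Qcone_def symmetric_mat_def psd_def matrix_vector_mult_diff_rdistrib inner_simps)
  then have "(r + (r' - r), A + (A' - A)) \<in> \<Theta> x" using \<Theta>(2) A by blast
  then show ?thesis by simp
qed

lemma inner_add_scaled_identity:
  fixes A :: "real^'n^'n"
  shows "w \<bullet> ((A + k *\<^sub>R mat 1) *v w) = w \<bullet> (A *v w) + k * (norm w)\<^sup>2"
  unfolding matrix_vector_mult_add_rdistrib scaleR_matrix_vector_assoc[symmetric] power2_norm_eq_inner
  by (simp add: inner_simps)

lemma transpose_add_scaled_identity:
  fixes A :: "real^'n^'n"
  assumes "transpose A = A"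
  shows "transpose (A + k *\<^sub>R mat 1) = A + k *\<^sub>R mat 1"
  using assms by (simp add: transpose_def vec_eq_iff mat_def)

lemma hausdorff_d_commute: "hausdorff_d \<Phi> \<Psi> = hausdorff_d \<Psi> \<Phi>"
  unfolding hausdorff_d_def by (rule arg_cong[where f = Inf]) auto

text \<open>Some jet of \<Theta> y lies within e < \<eta>, and the shift by (-\<eta>, \<eta> I)
  dominates the error in the order of the cone. Closeness of sets thus becomes an explicit
  correction of single jets.\<close>

lemma hausdorff_d_less_imp_mem:
  fixes A :: "real^'n^'n"
  assumes \<Theta>: "proper_elliptic_map \<Omega> \<Theta>" and x: "x \<in> \<Omega>" and y: "y \<in> \<Omega>"
    and d: "hausdorff_d (\<Theta> x) (\<Theta> y) < ereal \<eta>" and A: "(r, A) \<in> \<Theta> x"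
  shows "(r - \<eta>, A + \<eta> *\<^sub>R mat 1) \<in> \<Theta> y"
proof -
  obtain e where e: "e < \<eta>" "\<Theta> x \<subseteq> nbhd e (\<Theta> y)"
    using d unfolding hausdorff_d_def Inf_less_iff by auto
  then have "(r, A) \<in> nbhd e (\<Theta> y)" using A by blast
  then obtain s B where sB: "(s, B) \<in> \<Theta> y" "jet_dist (r, A) (s, B) < e" "(r, A) \<in> JSpace"
    unfolding nbhd_def by auto
  have sB': "(s, B) \<in> JSpace" using \<Theta> y sB(1) unfolding proper_elliptic_map_def by blast
  note near = jet_dist_less_imp[OF sB(3) sB' sB(2)]
  show ?thesis
  proof (rule proper_elliptic_map_mono[OF \<Theta> y sB(1)])
    show "r - \<eta> \<le> s" using near(1) e(1) by linarith
    show "transpose (A + \<eta> *\<^sub>R mat 1) = A + \<eta> *\<^sub>R mat 1"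
      using sB(3) by (intro transpose_add_scaled_identity) (simp add: JSpace_def Sym_def symmetric_mat_def)
    fix w :: "real^'n"
    have "e * (norm w)\<^sup>2 \<le> \<eta> * (norm w)\<^sup>2" using e(1) by (intro mult_right_mono) auto
    then show "w \<bullet> (B *v w) \<le> w \<bullet> ((A + \<eta> *\<^sub>R mat 1) *v w)"
      unfolding inner_add_scaled_identity using near(2)[of w] by linarith
  qed
qed

text \<open>Along the translation by x1 - y the penalty is constant, so the test function of
  \<open>U\<close>, translated and raised by that constant, tests \<open>f\<close> at
  \<open>y\<close> with the same Hessian.\<close>

lemma sup_convolution_test:
  fixes f :: "real^'n \<Rightarrow> ereal"
  assumes test: "test_above U A x1" and y: "f y = ereal (U x1 + c / 2 * (norm (x1 - y))\<^sup>2)"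
    and le: "\<And>x y. y \<in> S \<Longrightarrow> f y \<le> ereal (U x + c / 2 * (norm (x - y))\<^sup>2)"
    and T: "open T" "y \<in> T" "T \<subseteq> S"
  obtains \<phi> g e where "e > 0" "\<And>z. (\<phi> has_derivative (\<lambda>h. g z \<bullet> h)) (at z)"
    "\<And>z. (g has_derivative (\<lambda>h. A *v h)) (at z)"
    "f y = ereal (\<phi> y)" "\<And>z. z \<in> ball y e \<Longrightarrow> f z \<le> ereal (\<phi> z)"
proof -
  obtain \<phi> g e where e: "e > 0" and d: "\<And>y. (\<phi> has_derivative (\<lambda>h. g y \<bullet> h)) (at y)"
      "\<And>y. (g has_derivative (\<lambda>h. A *v h)) (at y)"
      and eq: "U x1 = \<phi> x1" and above: "\<And>y. y \<in> ball x1 e \<Longrightarrow> U y \<le> \<phi> y"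
    using test unfolding test_above_def by blast
  obtain e' where e': "e' > 0" "ball y e' \<subseteq> T" using T unfolding open_contains_ball by blast
  define s where "s = x1 - y"
  define \<phi>' where "\<phi>' z = \<phi> (z + s) + c / 2 * (norm s)\<^sup>2" for z
  have sh: "((\<lambda>z. z + s) has_derivative (\<lambda>h. h)) (at z)" for z by (auto intro!: derivative_eq_intros)
  show thesis
  proof (rule that[of "min e e'" \<phi>' "\<lambda>z. g (z + s)"])
    show "(\<phi>' has_derivative (\<lambda>h. g (z + s) \<bullet> h)) (at z)" for z
      unfolding \<phi>'_def using has_derivative_compose[OF sh d(1)] by (auto intro!: derivative_eq_intros)
    show "((\<lambda>z. g (z + s)) has_derivative (\<lambda>h. A *v h)) (at z)" for z
      using has_derivative_compose[OF sh d(2)] by simp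
    show "f y = ereal (\<phi>' y)" unfolding y \<phi>'_def s_def eq by simp
    fix z assume z: "z \<in> ball y (min e e')"
    then have "f z \<le> ereal (U (z + s) + c / 2 * (norm (z + s - z))\<^sup>2)" using e' T by (intro le) auto
    also have "U (z + s) \<le> \<phi> (z + s)" using z by (intro above) (auto simp: s_def dist_norm algebra_simps)
    finally show "f z \<le> ereal (\<phi>' z)" unfolding \<phi>'_def by simp
  qed (use e e' in auto)
qed

lemma usc_on_uminus:
  assumes "lsc_on S v"
  shows "usc_on S (\<lambda>x. - v x)"
  unfolding usc_on_def
proof (intro ballI conjI allI impI)
  fix x assume x: "x \<in> S"
  show "- v x \<noteq> \<infinity>" using assms x by (auto simp: lsc_on_def ereal_uminus_eq_reorder)
  fix c assume "- v x < c"
  then have "- c < v x" by (simp add: ereal_uminus_less_reorder)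
  then have "\<forall>\<^sub>F y in at x within S. - c < v y" using assms x by (auto simp: lsc_on_def)
  then show "\<forall>\<^sub>F y in at x within S. - v y < c"
    by eventually_elim (simp add: ereal_uminus_less_reorder)
qed

lemma usc_bounded_above:
  assumes "compact S" "usc_on S f"
  obtains B :: real where "\<And>y. y \<in> S \<Longrightarrow> f y \<le> ereal B"
proof (cases "S = {}")
  case False
  then obtain x where x: "x \<in> S" "\<forall>y\<in>S. f y \<le> f x" using usc_attains_max assms by blast
  then have "f x \<noteq> \<infinity>" using assms by (auto simp: usc_on_def)
  then obtain B where "f x \<le> ereal B" by (cases "f x") auto
  then show thesis using that x(2) order_trans by blast
qed (use that in auto)

text \<open>The added paraboloid has Hessian 2a I; removing it yields the strict gain that decides
  the final contradiction.\<close>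

lemma upper_jet_of_perturbation:
  fixes u :: "real^'n \<Rightarrow> ereal"
  assumes f: "\<And>z. f z = u z + ereal (a * (norm z)\<^sup>2 - b)"
    and "e > 0" and \<phi>: "\<And>z. (\<phi> has_derivative (\<lambda>h. g z \<bullet> h)) (at z)"
    and g: "\<And>z. (g has_derivative (\<lambda>h. A *v h)) (at z)"
    and eq: "f y = ereal (\<phi> y)" and le: "\<And>z. z \<in> ball y e \<Longrightarrow> f z \<le> ereal (\<phi> z)"
  shows "(\<phi> y - (a * (norm y)\<^sup>2 - b), A + (- 2 * a) *\<^sub>R mat 1) \<in> upper_jets u y"
proof -
  define \<phi>' where "\<phi>' z = \<phi> z - (a * (norm z)\<^sup>2 - b)" for z
  define g' where "g' z = g z + (- 2 * a) *\<^sub>R z" for z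
  have "C2_on_ball y e \<phi>' g' (\<lambda>_. A + (- 2 * a) *\<^sub>R mat 1)"
    unfolding C2_on_ball_def
  proof (intro conjI ballI)
    show "(\<phi>' has_derivative (\<lambda>h. g' x \<bullet> h)) (at x)" for x
      unfolding \<phi>'_def g'_def power2_norm_eq_inner
      by (auto intro!: derivative_eq_intros \<phi> simp: fun_eq_iff inner_simps inner_commute)
    show "(g' has_derivative (\<lambda>h. (A + (- 2 * a) *\<^sub>R mat 1) *v h)) (at x)" for x
      unfolding g'_def
      by (auto intro!: derivative_eq_intros g
          simp: fun_eq_iff matrix_vector_mult_diff_rdistrib scaleR_matrix_vector_assoc[symmetric])
  qed (use \<open>e > 0\<close> in auto)
  moreover have "u z \<le> ereal (\<phi>' z)" if "z \<in> ball y e" for z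
    using le[OF that] unfolding f \<phi>'_def by (cases "u z") auto
  moreover have "u y = ereal (\<phi>' y)" using eq unfolding f \<phi>'_def by (cases "u y") auto
  ultimately have "(\<phi>' y, A + (- 2 * a) *\<^sub>R mat 1) \<in> upper_jets u y"
    unfolding upper_jets_def
    by (intro CollectI exI[of _ \<phi>'] exI[of _ g'] exI[of _ "\<lambda>_. A + (- 2 * a) *\<^sub>R mat 1"] exI[of _ e]) auto
  then show ?thesis by (simp add: \<phi>'_def)
qed

lemma lower_jet_of_uminus:
  fixes v :: "real^'n \<Rightarrow> ereal"
  assumes "e > 0" and \<phi>: "\<And>z. (\<phi> has_derivative (\<lambda>h. g z \<bullet> h)) (at z)"
    and g: "\<And>z. (g has_derivative (\<lambda>h. A *v h)) (at z)"
    and eq: "- v y = ereal (\<phi> y)" and le: "\<And>z. z \<in> ball y e \<Longrightarrow> - v z \<le> ereal (\<phi> z)"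
  shows "(- \<phi> y, - A) \<in> lower_jets v y"
proof -
  have "C2_on_ball y e (\<lambda>z. - \<phi> z) (\<lambda>z. - g z) (\<lambda>_. - A)"
    unfolding C2_on_ball_def
  proof (intro conjI ballI)
    show "((\<lambda>z. - \<phi> z) has_derivative (\<lambda>h. - g x \<bullet> h)) (at x)" for x
      by (auto intro!: derivative_eq_intros \<phi>)
    show "((\<lambda>z. - g z) has_derivative (\<lambda>h. - A *v h)) (at x)" for x
      by (auto intro!: derivative_eq_intros g simp: uminus_matrix_vector)
  qed (use \<open>e > 0\<close> in auto)
  moreover have "ereal (- \<phi> z) \<le> v z" if "z \<in> ball y e" for z
    using le[OF that] by (cases "v z") auto
  moreover have "v y = ereal (- \<phi> y)" using eq by (cases "v y") auto
  ultimately show ?thesis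
    unfolding lower_jets_def
    by (intro CollectI exI[of _ "\<lambda>z. - \<phi> z"] exI[of _ "\<lambda>z. - g z"] exI[of _ "\<lambda>_. - A"] exI[of _ e]) auto
qed

text \<open>Prepares a Lebesgue number argument. Inside \<Omega> this is Hausdorff continuity; at
  the boundary, where \<Theta> is not controlled, semicontinuity and the boundary inequality rule
  out s + t \<ge> m, so the claim is vacuous.\<close>

lemma jet_transfer_radius:
  fixes \<Omega> :: "(real^'n::finite) set"
  assumes "open \<Omega>" and \<Theta>: "proper_elliptic_map \<Omega> \<Theta>" "hausdorff_continuous \<Omega> \<Theta>"
    and f: "usc_on (closure \<Omega>) f" and g: "usc_on (closure \<Omega>) g"
    and fr: "\<And>x. x \<in> frontier \<Omega> \<Longrightarrow> f x \<le> - g x"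
    and "m > 0" "\<eta> > 0" and x: "x \<in> closure \<Omega>"
  shows "\<exists>d>0. \<forall>y\<in>closure \<Omega> \<inter> ball x d. \<forall>z\<in>closure \<Omega> \<inter> ball x d. \<forall>s t.
    f y = ereal s \<longrightarrow> g z = ereal t \<longrightarrow> m \<le> s + t \<longrightarrow>
      y \<in> \<Omega> \<and> z \<in> \<Omega> \<and> (\<forall>r A. (r, A) \<in> \<Theta> y \<longrightarrow> (r - \<eta>, A + \<eta> *\<^sub>R mat 1) \<in> \<Theta> z)"
proof (cases "x \<in> \<Omega>")
  case True
  obtain d1 where d1: "d1 > 0" "ball x d1 \<subseteq> \<Omega>" using \<open>open \<Omega>\<close> True unfolding open_contains_ball by blast
  have "\<eta> / 2 > 0" using \<open>\<eta> > 0\<close> by simp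
  then obtain d2 where d2: "d2 > 0" "\<And>y. y \<in> \<Omega> \<Longrightarrow> dist x y < d2 \<Longrightarrow> hausdorff_d (\<Theta> x) (\<Theta> y) < ereal (\<eta> / 2)"
    using \<Theta>(2) True unfolding hausdorff_continuous_def by blast
  have "(r - \<eta>, A + \<eta> *\<^sub>R mat 1) \<in> \<Theta> z"
    if yz: "y \<in> ball x (min d1 d2)" "z \<in> ball x (min d1 d2)" and rA: "(r, A) \<in> \<Theta> y" for y z r A
  proof -
    have \<Omega>: "y \<in> \<Omega>" "z \<in> \<Omega>" using yz d1 by auto
    \<comment> \<open>Jets travel from \<open>y\<close> to \<open>z\<close> through the centre
      \<open>x\<close>, spending \<eta>/2 each time.\<close>
    have "hausdorff_d (\<Theta> y) (\<Theta> x) < ereal (\<eta> / 2)"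
      using d2(2)[OF \<Omega>(1)] yz(1) by (simp add: hausdorff_d_commute)
    from hausdorff_d_less_imp_mem[OF \<Theta>(1) \<Omega>(1) True this rA]
    have 1: "(r - \<eta> / 2, A + (\<eta> / 2) *\<^sub>R mat 1) \<in> \<Theta> x" .
    have "hausdorff_d (\<Theta> x) (\<Theta> z) < ereal (\<eta> / 2)" using d2(2)[OF \<Omega>(2)] yz(2) by simp
    from hausdorff_d_less_imp_mem[OF \<Theta>(1) True \<Omega>(2) this 1]
    have "(r - \<eta> / 2 - \<eta> / 2, A + ((\<eta> / 2) *\<^sub>R mat 1 + (\<eta> / 2) *\<^sub>R mat 1)) \<in> \<Theta> z" by (simp add: add.assoc)
    then show ?thesis by (simp flip: scaleR_add_left)
  qed
  moreover have "ball x (min d1 d2) \<subseteq> \<Omega>" using d1(2) by auto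
  moreover have "min d1 d2 > 0" using d1(1) d2(1) by simp
  ultimately show ?thesis by (intro exI[of _ "min d1 d2"]) blast
next
  case False
  then have "x \<in> frontier \<Omega>" using x \<open>open \<Omega>\<close> by (simp add: frontier_def interior_open)
  then have fx: "f x \<le> - g x" by (rule fr)
  have fin: "f x \<noteq> \<infinity>" "g x \<noteq> \<infinity>" using f g x by (auto simp: usc_on_def)
  \<comment> \<open>For finite \<open>f x\<close> the slack \<open>m\<close> is shared equally; if
    \<open>f x\<close> is -\<infinity>, any bound on \<open>g\<close> can be compensated.\<close>
  obtain c1 c2 where c: "f x < ereal c1" "g x < ereal c2" "c1 + c2 \<le> m"
  proof (cases "f x")
    case (real s)
    then have "g x \<le> ereal (- s)" using fx by (cases "g x") auto
    also have "\<dots> < ereal (- s + m / 2)" using \<open>m > 0\<close> by simp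
    finally show thesis using that[of "s + m / 2" "- s + m / 2"] real \<open>m > 0\<close> by simp
  next
    case MInf
    obtain c2 where "g x < ereal c2" using fin(2) by (metis less_PInf_Ex_of_nat ereal_infty_less(1))
    then show thesis using that[of "m - c2" c2] MInf by simp
  qed (use fin in auto)
  have nbhd: "\<exists>d>0. \<forall>y\<in>closure \<Omega> \<inter> ball x d. h y < ereal c"
    if "usc_on (closure \<Omega>) h" "h x < ereal c" for h c
  proof -
    have "\<forall>\<^sub>F y in at x within closure \<Omega>. h y < ereal c"
      using that x unfolding usc_on_def by blast
    then obtain d where d: "d > 0" "\<And>y. y \<in> closure \<Omega> \<Longrightarrow> y \<noteq> x \<Longrightarrow> dist y x < d \<Longrightarrow> h y < ereal c"
      unfolding eventually_at by auto
    have "h y < ereal c" if "y \<in> closure \<Omega> \<inter> ball x d" for y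
      using d(2)[of y] that \<open>h x < ereal c\<close> by (cases "y = x") (auto simp: dist_commute)
    then show ?thesis using d(1) by blast
  qed
  obtain d1 d2 where "d1 > 0" "d2 > 0" "\<forall>y\<in>closure \<Omega> \<inter> ball x d1. f y < ereal c1"
      "\<forall>z\<in>closure \<Omega> \<inter> ball x d2. g z < ereal c2"
    using nbhd[OF f c(1)] nbhd[OF g c(2)] by blast
  moreover have False if "f y = ereal s" "g z = ereal t" "m \<le> s + t" "f y < ereal c1" "g z < ereal c2" for y z s t
    using that c(3) by auto
  moreover have "ball x (min d1 d2) \<subseteq> ball x d1" "ball x (min d1 d2) \<subseteq> ball x d2" "min d1 d2 > 0"
    using \<open>d1 > 0\<close> \<open>d2 > 0\<close> by auto
  ultimately show ?thesis by (intro exI[of _ "min d1 d2"]) blast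
qed

section \<open>Comparison by doubling with sup-convolutions\<close>

theorem theorem5p1:
  fixes \<Omega> :: "(real^'n::finite) set"
    and \<Theta> :: "real^'n \<Rightarrow> ('n jet) set"
    and u v :: "real^'n \<Rightarrow> ereal"
  assumes "bounded \<Omega>" and "open \<Omega>" and "connected \<Omega>"
    and "proper_elliptic_map \<Omega> \<Theta>" and "hausdorff_continuous \<Omega> \<Theta>"
    and "usc_on (closure \<Omega>) u" and "lsc_on (closure \<Omega>) v"
    and "subharmonic \<Theta> \<Omega> u" and "superharmonic \<Theta> \<Omega> v"
    and "\<forall>x\<in>frontier \<Omega>. u x \<le> v x"
  shows "\<forall>x\<in>\<Omega>. u x \<le> v x"
proof (rule ccontr)
  assume "\<not> (\<forall>x\<in>\<Omega>. u x \<le> v x)"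
  then obtain x0 where x0: "x0 \<in> \<Omega>" "v x0 < u x0" by auto
  define S where "S = closure \<Omega>"
  have S: "compact S" "\<Omega> \<subseteq> S" unfolding S_def using \<open>bounded \<Omega>\<close> closure_subset by auto
  have usc: "usc_on S u" "usc_on S (\<lambda>x. - v x)"
    unfolding S_def using assms(6,7) usc_on_uminus by blast+
  obtain \<alpha> \<beta> where \<alpha>\<beta>: "u x0 = ereal \<alpha>" "v x0 = ereal \<beta>" "\<beta> < \<alpha>"
  proof -
    have "u x0 \<noteq> \<infinity>" "v x0 \<noteq> -\<infinity>"
      using usc x0(1) S(2) by (auto simp: usc_on_def ereal_uminus_eq_reorder)
    then show thesis using that x0(2) by (cases "u x0"; cases "v x0") auto
  qed
  obtain R where R: "\<And>x. x \<in> S \<Longrightarrow> norm x \<le> R" using compact_imp_bounded[OF S(1)] by (auto simp: bounded_iff)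
  \<comment> \<open>Half the excess at \<open>x0\<close>: the perturbation may consume
    \<open>m\<close>, and \<open>m\<close> remains.\<close>
  define m where "m = (\<alpha> - \<beta>) / 2"
  have m: "m > 0" using \<alpha>\<beta> by (simp add: m_def)
  define a where "a = m / (R\<^sup>2 + 1)"
  have a: "a > 0" "a * R\<^sup>2 \<le> m"
  proof -
    have p: "R\<^sup>2 + 1 > 0" by (simp add: add_nonneg_pos)
    then show "a > 0" using m by (simp add: a_def)
    have "a * R\<^sup>2 \<le> a * (R\<^sup>2 + 1)" using \<open>a > 0\<close> by (intro mult_left_mono) auto
    then show "a * R\<^sup>2 \<le> m" using p by (simp add: a_def)
  qed
  \<comment> \<open>\<eta> is spent twice, on transferring the jet and on the ball around the jet of
    \<open>v\<close>. Both must fit, with two test errors a/4, into the Hessian gain 2a, and into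
    m/2 for the values.\<close>
  define \<eta> where "\<eta> = min (a / 4) (m / 4)"
  have \<eta>: "\<eta> > 0" "\<eta> \<le> a / 4" "\<eta> \<le> m / 4" using a m by (auto simp: \<eta>_def)
  define h where "h y = a * (norm y)\<^sup>2 - a * R\<^sup>2" for y :: "real^'n"
  define f where "f y = u y + ereal (h y)" for y
  define g where "g y = - v y" for y
  have h0: "h y \<le> 0" if "y \<in> S" for y
    unfolding h_def using R[OF that] a(1) by (simp add: mult_left_mono power_mono)
  have f: "usc_on S f" unfolding f_def h_def by (intro usc_on_add_continuous[OF usc(1)] continuous_intros)
  have g: "usc_on S g" unfolding g_def by (rule usc(2))
  have fg0: "f x0 = ereal (\<alpha> + h x0)" "g x0 = ereal (- \<beta>)" "m \<le> \<alpha> + h x0 - \<beta>"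
  proof -
    have "0 \<le> a * (norm x0)\<^sup>2" using a(1) by simp
    then show "m \<le> \<alpha> + h x0 - \<beta>" unfolding h_def using a(2) by (simp add: m_def field_simps)
  qed (simp_all add: f_def g_def \<alpha>\<beta>)
  have fr: "f x \<le> - g x" if "x \<in> frontier \<Omega>" for x
  proof -
    have "f x \<le> u x" unfolding f_def
      using h0[of x] that by (cases "u x") (auto simp: S_def frontier_def)
    also have "u x \<le> v x" using assms(10) that by blast
    finally show ?thesis by (simp add: g_def)
  qed
  obtain d where d: "\<And>x. x \<in> S \<Longrightarrow> d x > 0 \<and> (\<forall>y\<in>S \<inter> ball x (d x). \<forall>z\<in>S \<inter> ball x (d x). \<forall>s t.
    f y = ereal s \<longrightarrow> g z = ereal t \<longrightarrow> m / 2 \<le> s + t \<longrightarrow>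
      y \<in> \<Omega> \<and> z \<in> \<Omega> \<and> (\<forall>r A. (r, A) \<in> \<Theta> y \<longrightarrow> (r - \<eta>, A + \<eta> *\<^sub>R mat 1) \<in> \<Theta> z))"
  proof -
    have "m / 2 > 0" using m by simp
    from jet_transfer_radius[OF assms(2,4,5) f[unfolded S_def] g[unfolded S_def] fr this \<eta>(1), folded S_def]
    show thesis using that by metis
  qed
  \<comment> \<open>The radii depend on the centre; a Lebesgue number of the compact closure makes
    them uniform.\<close>
  obtain \<delta> where \<delta>: "\<delta> > 0" "\<And>x. x \<in> S \<Longrightarrow> \<exists>G\<in>(\<lambda>x. ball x (d x)) ` S. ball x \<delta> \<subseteq> G"
    by (rule Heine_Borel_lemma[OF S(1), of "(\<lambda>x. ball x (d x)) ` S"]) (use d in auto)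
  have transfer: "y \<in> \<Omega> \<and> z \<in> \<Omega> \<and> (\<forall>r A. (r, A) \<in> \<Theta> y \<longrightarrow> (r - \<eta>, A + \<eta> *\<^sub>R mat 1) \<in> \<Theta> z)"
    if yzS: "y \<in> S" "z \<in> S" "dist y z < \<delta>" and st: "f y = ereal s" "g z = ereal t" "m / 2 \<le> s + t" for y z s t
  proof -
    obtain x where x: "x \<in> S" "ball y \<delta> \<subseteq> ball x (d x)" using \<delta>(2)[OF yzS(1)] by blast
    moreover have "y \<in> ball y \<delta>" "z \<in> ball y \<delta>" using yzS(3) \<delta>(1) by auto
    ultimately have "y \<in> S \<inter> ball x (d x)" "z \<in> S \<inter> ball x (d x)" using yzS(1,2) by blast+
    then show ?thesis using d[OF x(1)] st by blast
  qed
  obtain B where B: "B \<ge> 0" "\<And>y. y \<in> S \<Longrightarrow> f y \<le> ereal B" "\<And>y. y \<in> S \<Longrightarrow> g y \<le> ereal B"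
  proof -
    obtain B1 where B1: "\<And>y. y \<in> S \<Longrightarrow> f y \<le> ereal B1" using usc_bounded_above[OF S(1) f] by blast
    obtain B2 where B2: "\<And>y. y \<in> S \<Longrightarrow> g y \<le> ereal B2" using usc_bounded_above[OF S(1) g] by blast
    have "ereal B1 \<le> ereal (max 0 (max B1 B2))" "ereal B2 \<le> ereal (max 0 (max B1 B2))"
      unfolding ereal_less_eq by simp_all
    then show thesis using that[of "max 0 (max B1 B2)"] B1 B2 by (meson max.cobounded1 order_trans)
  qed
  \<comment> \<open>With this \<open>c\<close>, a penalty of at most 2B keeps a maximiser within
    \<delta>/3 of its point.\<close>
  define c where "c = 36 * (B + 1) / \<delta>\<^sup>2"
  have c: "c > 0" "c / 2 * (\<delta> / 3)\<^sup>2 = 2 * (B + 1)"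
    using B(1) \<delta>(1) by (auto simp: c_def power2_eq_square field_simps)
  have x0S: "x0 \<in> S" using x0 S by blast
  obtain U where U: "semiconvex c U" "\<And>x. \<exists>y\<in>S. f y = ereal (U x + c / 2 * (norm (x - y))\<^sup>2)"
    "\<And>x y. y \<in> S \<Longrightarrow> f y \<le> ereal (U x + c / 2 * (norm (x - y))\<^sup>2)"
    using sup_convolution[OF S(1) f x0S, of c] fg0(1) by auto
  obtain W where W: "semiconvex c W" "\<And>x. \<exists>y\<in>S. g y = ereal (W x + c / 2 * (norm (x - y))\<^sup>2)"
    "\<And>x y. y \<in> S \<Longrightarrow> g y \<le> ereal (W x + c / 2 * (norm (x - y))\<^sup>2)"
    using sup_convolution[OF S(1) g x0S, of c] fg0(2) by auto
  have growth: "U x + W x \<le> (2 * B + c / 2 * R\<^sup>2) - c / 4 * (norm x)\<^sup>2" for x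
  proof -
    obtain y where y: "y \<in> S" "f y = ereal (U x + c / 2 * (norm (x - y))\<^sup>2)" using U(2) by blast
    obtain z where z: "z \<in> S" "g z = ereal (W x + c / 2 * (norm (x - z))\<^sup>2)" using W(2) by blast
    have "(norm x)\<^sup>2 \<le> (norm (x - y) + R)\<^sup>2"
      using norm_triangle_ineq[of "x - y" y] R[OF y(1)] by (intro power_mono) auto
    also have "\<dots> \<le> 2 * (norm (x - y))\<^sup>2 + 2 * R\<^sup>2"
      using zero_le_power2[of "norm (x - y) - R"] by (simp add: power2_eq_square algebra_simps)
    finally have "c / 4 * (norm x)\<^sup>2 \<le> c / 4 * (2 * (norm (x - y))\<^sup>2 + 2 * R\<^sup>2)"
      using c(1) by (intro mult_left_mono) auto
    then have "c / 4 * (norm x)\<^sup>2 \<le> c / 2 * (norm (x - y))\<^sup>2 + c / 2 * R\<^sup>2" by (simp add: algebra_simps)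
    moreover have "U x + c / 2 * (norm (x - y))\<^sup>2 \<le> B" using B(2)[OF y(1)] y(2) by simp
    moreover have "W x + c / 2 * (norm (x - z))\<^sup>2 \<le> B" using B(3)[OF z(1)] z(2) by simp
    moreover have "0 \<le> c / 2 * (norm (x - z))\<^sup>2" using c(1) by simp
    ultimately show ?thesis by linarith
  qed
  define \<tau> where "\<tau> = min (\<delta> / 3) (m / 2)"
  have \<tau>: "\<tau> > 0" "\<tau> \<le> \<delta> / 3" "\<tau> \<le> m / 2" using \<delta>(1) m by (auto simp: \<tau>_def)
  have "c / 4 > 0" "a / 4 > 0" using c(1) a(1) by auto
  obtain x1 x2 A where x12: "dist x1 x2 < \<tau>" "U x0 + W x0 - \<tau> < U x1 + W x2" and A: "transpose A = A"
    and test: "test_above U (A + (a / 4) *\<^sub>R mat 1) x1" "test_above W (- A + (a / 4) *\<^sub>R mat 1) x2"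
    by (rule simultaneous_test_points[OF U(1) W(1) c(1) growth \<open>c / 4 > 0\<close> \<open>a / 4 > 0\<close> \<tau>(1)]) (rule that)
  obtain y where y: "y \<in> S" "f y = ereal (U x1 + c / 2 * (norm (x1 - y))\<^sup>2)" using U(2) by blast
  obtain z where z: "z \<in> S" "g z = ereal (W x2 + c / 2 * (norm (x2 - z))\<^sup>2)" using W(2) by blast
  define s where "s = U x1 + c / 2 * (norm (x1 - y))\<^sup>2"
  define t where "t = W x2 + c / 2 * (norm (x2 - z))\<^sup>2"
  have pos: "0 \<le> c / 2 * (norm (x1 - y))\<^sup>2" "0 \<le> c / 2 * (norm (x2 - z))\<^sup>2" using c(1) by auto
  have "\<alpha> + h x0 \<le> U x0" "- \<beta> \<le> W x0"
    using U(3)[OF x0S, of x0] W(3)[OF x0S, of x0] fg0 by auto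
  then have UW: "m / 2 < U x1 + W x2" using x12(2) \<tau>(3) fg0(3) by linarith
  then have st: "m / 2 \<le> s + t" using pos unfolding s_def t_def by linarith
  have sB: "s \<le> B" "t \<le> B" using B(2)[OF y(1)] B(3)[OF z(1)] y z by (auto simp: s_def t_def)
  have close: "r < \<delta> / 3" if "c / 2 * r\<^sup>2 \<le> 2 * B" for r
  proof (rule ccontr)
    assume "\<not> r < \<delta> / 3"
    then have "c / 2 * (\<delta> / 3)\<^sup>2 \<le> c / 2 * r\<^sup>2" using c(1) \<delta>(1) by (intro mult_left_mono power_mono) auto
    then have "2 * (B + 1) \<le> 2 * B" unfolding c(2) using that by (rule order_trans)
    then show False by simp
  qed
  \<comment> \<open>Since \<open>s\<close> and \<open>t\<close> are at most \<open>B\<close> while U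
    x1 + W x2 is positive, each penalty is below 2B.\<close>
  have "norm (x1 - y) < \<delta> / 3" "norm (x2 - z) < \<delta> / 3"
    using sB UW m pos unfolding s_def t_def by (intro close; linarith)+
  then have "dist y z < \<delta>"
    using x12(1) \<tau>(2) dist_triangle[of y z x1] dist_triangle[of x1 z x2] by (simp add: dist_norm norm_minus_commute)
  then have yz: "y \<in> \<Omega>" "z \<in> \<Omega>" and tr: "\<And>r A. (r, A) \<in> \<Theta> y \<Longrightarrow> (r - \<eta>, A + \<eta> *\<^sub>R mat 1) \<in> \<Theta> z"
    using transfer[OF y(1) z(1) _ y(2) z(2)] st unfolding s_def t_def by blast+
  have "(s - h y, A + (a / 4) *\<^sub>R mat 1 + (- 2 * a) *\<^sub>R mat 1) \<in> upper_jets u y"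
  proof (rule sup_convolution_test[OF test(1) y(2) U(3) \<open>open \<Omega>\<close> yz(1) S(2)])
    fix \<phi> :: "real^'n \<Rightarrow> real" and G e
    assume *: "e > 0" "\<And>z. (\<phi> has_derivative (\<lambda>h. G z \<bullet> h)) (at z)"
      "\<And>z. (G has_derivative (\<lambda>h. (A + (a / 4) *\<^sub>R mat 1) *v h)) (at z)"
      "f y = ereal (\<phi> y)" "\<And>z. z \<in> ball y e \<Longrightarrow> f z \<le> ereal (\<phi> z)"
    have "\<phi> y = s" using *(4) y(2) by (simp add: s_def)
    with upper_jet_of_perturbation[OF f_def[unfolded h_def] *] show ?thesis by (simp add: h_def)
  qed
  then have "(s - h y, A + (a / 4) *\<^sub>R mat 1 + (- 2 * a) *\<^sub>R mat 1) \<in> \<Theta> y"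
    using assms(8) yz(1) unfolding subharmonic_def by blast
  then have jet: "(s - h y - \<eta>, A + (a / 4) *\<^sub>R mat 1 + (- 2 * a) *\<^sub>R mat 1 + \<eta> *\<^sub>R mat 1) \<in> \<Theta> z" by (rule tr)
  have "(- t, - (- A + (a / 4) *\<^sub>R mat 1)) \<in> lower_jets v z"
  proof (rule sup_convolution_test[OF test(2) z(2) W(3) \<open>open \<Omega>\<close> yz(2) S(2)])
    fix \<phi> :: "real^'n \<Rightarrow> real" and G e
    assume *: "e > 0" "\<And>z. (\<phi> has_derivative (\<lambda>h. G z \<bullet> h)) (at z)"
      "\<And>z. (G has_derivative (\<lambda>h. (- A + (a / 4) *\<^sub>R mat 1) *v h)) (at z)"
      "g z = ereal (\<phi> z)" "\<And>x. x \<in> ball z e \<Longrightarrow> g x \<le> ereal (\<phi> x)"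
    have "\<phi> z = t" using *(4) z(2) by (simp add: t_def)
    with lower_jet_of_uminus[OF *[unfolded g_def]] show ?thesis by simp
  qed
  then have low: "(- t, - (- A + (a / 4) *\<^sub>R mat 1)) \<in> JSpace - jet_interior (\<Theta> z)"
    using assms(9) yz(2) unfolding superharmonic_def by blast
  \<comment> \<open>Every jet within \<eta> of the lower jet of \<open>v\<close> dominates the
    transferred jet of \<open>u\<close> in the order of the cone, so the lower jet is interior to
    \<Theta> z, which superharmonicity forbids.\<close>
  have "(- t, - (- A + (a / 4) *\<^sub>R mat 1)) \<in> jet_interior (\<Theta> z)"
    unfolding jet_interior_def
  proof (intro CollectI conjI exI[of _ \<eta>] ballI impI)
    show "(- t, - (- A + (a / 4) *\<^sub>R mat 1)) \<in> JSpace" using low by blast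
    fix q :: "'n jet" assume q: "q \<in> JSpace" and dq: "jet_dist q (- t, - (- A + (a / 4) *\<^sub>R mat 1)) < \<eta>"
    obtain r C where rC: "q = (r, C)" by force
    have near: "\<bar>r - - t\<bar> < \<eta>"
       "w \<bullet> (- (- A + (a / 4) *\<^sub>R mat 1) *v w) - \<eta> * (norm w)\<^sup>2 \<le> w \<bullet> (C *v w)" for w
      using jet_dist_less_imp[of r C "- t" "- (- A + (a / 4) *\<^sub>R mat 1)" \<eta>] q dq low unfolding rC by blast+
    show "q \<in> \<Theta> z"
      unfolding rC
    proof (rule proper_elliptic_map_mono[OF assms(4) yz(2) jet])
      show "r \<le> s - h y - \<eta>" using near(1) h0[OF y(1)] st \<eta>(3) by linarith
      show "transpose C = C" using q rC by (simp add: JSpace_def Sym_def symmetric_mat_def)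
      fix w :: "real^'n"
      have "w \<bullet> (- (- A + (a / 4) *\<^sub>R mat 1) *v w) = w \<bullet> (A *v w) - a / 4 * (norm w)\<^sup>2"
        unfolding uminus_matrix_vector inner_minus_right inner_add_scaled_identity by simp
      moreover have "w \<bullet> ((A + (a / 4) *\<^sub>R mat 1 + (- 2 * a) *\<^sub>R mat 1 + \<eta> *\<^sub>R mat 1) *v w)
        = w \<bullet> (A *v w) + a / 4 * (norm w)\<^sup>2 - 2 * a * (norm w)\<^sup>2 + \<eta> * (norm w)\<^sup>2"
        unfolding inner_add_scaled_identity by simp
      moreover have "\<eta> * (norm w)\<^sup>2 \<le> a / 4 * (norm w)\<^sup>2" using \<eta>(2) by (intro mult_right_mono) auto
      moreover have "0 \<le> a * (norm w)\<^sup>2" using a(1) by simp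
      ultimately show "w \<bullet> ((A + (a / 4) *\<^sub>R mat 1 + (- 2 * a) *\<^sub>R mat 1 + \<eta> *\<^sub>R mat 1) *v w) \<le> w \<bullet> (C *v w)"
        using near(2)[of w] by (simp add: algebra_simps)
    qed
  qed (use \<eta> in auto)
  with low show False by blast
qed

end
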